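(* Let $P$ be the uniform distribution on the boundary of the equilateral triangle with vertices $O(0,0)$, $A(1,0)$, $B(\frac12,\frac{\sqrt3}{2})$. Let $n\in\mathbb{N}$ with $n\geq 6$ and $n=3k+3$ for some positive integer $k$. Put $$r=\frac{8-2\sqrt7\,k}{16-7k^2},\qquad \gamma=\Big\{\Big(r+\frac{2j-1}{2k}(1-2r),\,0\Big) : j=1,2,\dots,k\Big\}\subset\mathbb{R}^2,$$ and let $T_1,T_2$ be affine transformations of $\mathbb{R}^2$ such that $T_1(0,0)=(\frac12,\frac{\sqrt3}{2})$, $T_1(1,0)=(1,0)$, $T_2(0,0)=(0,0)$ and $T_2(1,0)=(\frac12,\frac{\sqrt3}{2})$. Then the optimal set of $n$-means for $P$ is $$\alpha_n=\Big\{\Big(\frac{3r}{8},\frac{\sqrt3\,r}{8}\Big),\ \Big(1-\frac{3r}{8},\frac{\sqrt3\,r}{8}\Big),\ \Big(\frac12,-\frac{\sqrt3}{4}(r-2)\Big)\Big\}\cup\gamma\cup T_1(\gamma)\cup T_2(\gamma),$$ and the $n$th quantization error is $$V_n(P)=\frac{7\left(7k^2-8\sqrt7\,k+16\right)}{12\left(16-7k^2\right)^2}.$$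
   Context: The uniform distribution $P$ on the boundary $L$ of the triangle (the union of its three sides, of total length $3$) is the Borel probability measure on $\mathbb{R}^2$ supported on $L$ given by $dP=\frac13\,ds$, where $s$ is arc length along $L$. For a Borel probability measure $P$ on $\mathbb{R}^d$ (here $d=2$) with $\int\|x\|^2dP(x)<\infty$ and a nonempty finite set $\alpha\subset\mathbb{R}^d$, put $V(P;\alpha)=\int\min_{c\in\alpha}\|x-c\|^2\,dP(x)$, with $\|\cdot\|$ the Euclidean norm. The $n$th quantization error is $V_n(P)=\inf\{V(P;\alpha):\alpha\subset\mathbb{R}^d,\ 1\le\operatorname{card}(\alpha)\leq n\}$. An optimal set of $n$-means for $P$ is a set $\alpha$ with at most $n$ points for which this infimum is attained. $\mathbb{N}=\{1,2,3,\dots\}$. *)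

theory Defs
  imports "HOL-Analysis.Analysis"
begin

text \<open>
  The definitions are meaningful for Borel probability measures with finite second moment;
  otherwise the Bochner integral may take its default value 0.
\<close>

definition distortion :: "('a::euclidean_space) measure \<Rightarrow> 'a set \<Rightarrow> real" where
  "distortion P \<alpha> = (LINT x|P. (MIN c\<in>\<alpha>. (norm (x - c))\<^sup>2))"

definition quantization_error :: "('a::euclidean_space) measure \<Rightarrow> nat \<Rightarrow> real" where
  "quantization_error P n =
     (INF \<alpha>\<in>{\<alpha>. finite \<alpha> \<and> 1 \<le> card \<alpha> \<and> card \<alpha> \<le> n}. distortion P \<alpha>)"

definition optimal_n_means :: "('a::euclidean_space) measure \<Rightarrow> nat \<Rightarrow> 'a set \<Rightarrow> bool" where
  "optimal_n_means P n \<alpha> \<longleftrightarrow>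
     finite \<alpha> \<and> 1 \<le> card \<alpha> \<and> card \<alpha> \<le> n \<and> distortion P \<alpha> = quantization_error P n"

definition affine_map :: "('a::real_vector \<Rightarrow> 'b::real_vector) \<Rightarrow> bool" where
  "affine_map T \<longleftrightarrow> (\<exists>f b. linear f \<and> T = (\<lambda>x. f x + b))"

definition vO :: "real^2" where "vO = vector [0, 0]"
definition vA :: "real^2" where "vA = vector [1, 0]"
definition vB :: "real^2" where "vB = vector [1/2, sqrt 3 / 2]"

definition triangle_boundary :: "(real^2) set" where
  "triangle_boundary = closed_segment vO vA \<union> closed_segment vA vB \<union> closed_segment vB vO"

text \<open>
  Since each side has length 1, the following traverses the boundary once at unit speed as
  \<open>t\<close> runs over the interval from 0 to 3, so \<open>t\<close> is arc length along the boundary.  Hence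
  pushing forward Lebesgue measure on this interval, normalised by \<open>1/3\<close>, gives \<open>dP = ds/3\<close>.
\<close>

definition boundary_param :: "real \<Rightarrow> real^2" where
  "boundary_param t =
     (if t \<le> 1 then linepath vO vA t
      else if t \<le> 2 then linepath vA vB (t - 1)
      else linepath vB vO (t - 2))"

definition uniform_triangle :: "(real^2) measure" where
  "uniform_triangle = distr (uniform_measure lborel {0..3}) borel boundary_param"

lemma side_lengths: "dist vO vA = 1" "dist vA vB = 1" "dist vB vO = 1"
  by (simp_all add: vO_def vA_def vB_def dist_vec_def L2_set_def sum_2 dist_real_def
      power2_eq_square)

lemma boundary_param_image: "boundary_param ` {0..3} = triangle_boundary"
proof -
  have split: "{0..3::real} = {0..1} \<union> {1<..2} \<union> {2<..3}" by auto
  have end1: "linepath vO vA 1 = vA" "linepath vA vB 0 = vA"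
    "linepath vA vB 1 = vB" "linepath vB vO 0 = vB"
    by (simp_all add: linepath_def)
  have a: "boundary_param ` {0..1} = closed_segment vO vA"
    by (simp add: boundary_param_def linepath_image_01[symmetric] cong: image_cong_simp)
  have b: "boundary_param ` {1<..2} = linepath vA vB ` {0<..1}"
  proof -
    have "boundary_param ` {1<..2} = linepath vA vB ` ((\<lambda>t. t - 1) ` {1<..2})"
      unfolding image_image by (rule image_cong) (auto simp: boundary_param_def)
    also have "(\<lambda>t. t - 1) ` {1<..2} = {0<..1::real}"
      by (auto intro!: image_eqI[where x="_ + 1"])
    finally show ?thesis .
  qed
  have c: "boundary_param ` {2<..3} = linepath vB vO ` {0<..1}"
  proof -
    have "boundary_param ` {2<..3} = linepath vB vO ` ((\<lambda>t. t - 2) ` {2<..3})"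
      unfolding image_image by (rule image_cong) (auto simp: boundary_param_def)
    also have "(\<lambda>t. t - 2) ` {2<..3} = {0<..1::real}"
      by (auto intro!: image_eqI[where x="_ + 2"])
    finally show ?thesis .
  qed
  have d: "{0..1::real} = insert 0 {0<..1}" by auto
  have ab: "closed_segment vA vB = insert vA (linepath vA vB ` {0<..1})"
    by (simp add: linepath_image_01[symmetric] d end1)
  have bo: "closed_segment vB vO = insert vB (linepath vB vO ` {0<..1})"
    by (simp add: linepath_image_01[symmetric] d end1)
  have "vA \<in> closed_segment vO vA" by simp
  moreover have "vB \<in> linepath vA vB ` {0<..1}"
    using end1(3) by (metis greaterThanAtMost_iff image_eqI order_refl zero_less_one)
  ultimately show ?thesis
    unfolding split image_Un a b c triangle_boundary_def ab bo by auto
qed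

lemma boundary_param_measurable [measurable]: "boundary_param \<in> borel_measurable borel"
  unfolding boundary_param_def linepath_def by measurable

lemma uniform_triangle_space [simp]: "space uniform_triangle = UNIV"
  and uniform_triangle_sets [simp]: "sets uniform_triangle = sets borel"
  by (simp_all add: uniform_triangle_def)

lemma uniform_triangle_total: "emeasure uniform_triangle UNIV = 1"
  unfolding uniform_triangle_def
  by (subst emeasure_distr) (simp_all add: divide_eq_1_ennreal)

lemma uniform_triangle_support: "AE x in uniform_triangle. x \<in> triangle_boundary"
proof -
  have closed: "closed triangle_boundary"
    by (simp add: triangle_boundary_def closed_Un)
  have "AE t in uniform_measure lborel {0..3}. boundary_param t \<in> triangle_boundary"
    by (rule AE_uniform_measureI) (auto simp flip: boundary_param_image)
  moreover have "boundary_param \<in> measurable (uniform_measure lborel {0..3}) borel"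
    by simp
  ultimately show ?thesis
    using closed unfolding uniform_triangle_def
    by (subst AE_distr_iff) auto
qed

lemma uniform_triangle_second_moment: "integrable uniform_triangle (\<lambda>x. (norm x)\<^sup>2)"
proof -
  have "bounded triangle_boundary"
    by (simp add: triangle_boundary_def compact_imp_bounded)
  then obtain C where C: "\<And>x. x \<in> triangle_boundary \<Longrightarrow> norm x \<le> C"
    by (auto simp: bounded_iff)
  interpret finite_measure uniform_triangle
    by standard (simp add: uniform_triangle_total)
  show ?thesis
  proof (rule integrable_const_bound)
    show "AE x in uniform_triangle. norm ((norm x)\<^sup>2) \<le> C\<^sup>2"
      using uniform_triangle_support by eventually_elim (simp add: C power_mono)
  qed (simp add: measurable_cong_sets[OF uniform_triangle_sets refl])
qed

end

theory Submission
  imports Defs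
begin

text \<open>
  Why the configuration is optimal. Write \<open>r = 2 / (4 + sqrt 7 * k)\<close>. In the configuration of the theorem each
  corner point serves the two pieces of length \<open>r\<close> at its vertex, and the middle of each side, of length
  \<open>1 - 2 * r\<close>, is split into \<open>k\<close> cells of length \<open>d = sqrt 7 / 2 * r\<close> served by their midpoints. At every
  end of a cell the squared distance to the serving points is \<open>7/16 * r^2 = (d/2)^2\<close>.

  The lower bound is linear programming duality. Let \<open>W\<close> be any weight on the boundary and call the
  integral \<open>G c\<close> of the positive part of \<open>W x - |x - c|^2\<close> over the boundary the gain of the point
  \<open>c\<close>. As a maximum of positive parts is at most their sum, every finite set satisfies
  \<open>integral of min |x - c|^2 >= integral of W - sum of G c\<close>. So if no point of the plane gains more than
  a price \<open>p\<close>, then \<open>n\<close> points have distortion at least \<open>integral of W - n * p\<close>, and no Voronoi cells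
  have to be considered. The weight used here is \<open>7/16 * r^2\<close> in the middle of each side
  and drops linearly within distance \<open>r\<close> of the vertices (\<open>dual_weight\<close>), with the slope chosen such that corner
  points and midpoints of full cells gain the same amount, the price \<open>7 * sqrt 7 / 48 * r^3\<close>. For \<open>n = 3 * k + 3\<close> the
  resulting bound is the value of the theorem (\<open>dual_value\<close>).

  What has to be shown is that no point gains more than the price. A point that profits on one side only
  gains at most what the midpoint of a full cell gains (\<open>side_gain_le_price\<close>). As the weight is small, no point
  profits on all three sides (\<open>some_side_inactive\<close>), so what remains is a point that profits on two sides
  meeting at a vertex (\<open>corner_gain\<close>). If it serves the vertex, its gain is bounded by a function of the
  reach on the two sides, whose maximum is the corner point (\<open>corner_cell_cost_estimate\<close>); if not,
  it serves two chords of a disc that does not contain the vertex in its interior, which is slightly worse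
  (\<open>two_chords_cost_estimate\<close>).

  Uniqueness comes from complementary slackness: in an optimal set every point gains the full price, so it is a
  corner point or lies on a side with a full cell around it, and no boundary point profits from two points. The
  side points therefore keep distance \<open>d\<close>, and exactly \<open>k\<close> of them fit on a side in exactly one way
  (\<open>triangle_distortion_lower_bound\<close>).
\<close>

section \<open>Two inequalities for the cell at a vertex\<close>

text \<open>
  The slope at which the weight introduced below falls off towards a vertex. The value is forced:
  in units where \<open>r = 1\<close>, the corner point then gains
  \<open>2 * 7/16 - corner_slope - 7/24 = 7 * sqrt 7 / 48\<close>, exactly what a point in the middle of a side gains.
\<close>

definition corner_slope :: real where
  "corner_slope = 7 * (4 - sqrt 7) / 48"

lemma sqrt7_bounds: "26457/10000 < sqrt (7::real)" "sqrt (7::real) < 13229/5000"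
  by (rule real_less_rsqrt, simp add: power2_eq_square)
     (rule real_less_lsqrt, simp_all add: power2_eq_square)

lemma corner_slope_bounds: "4937/25000 < corner_slope" "corner_slope < 19751/100000"
  using sqrt7_bounds by (auto simp: corner_slope_def field_simps)

text \<open>
  The gain, in units where \<open>r = 1\<close>, of a point that serves the first \<open>x1\<close> and \<open>x2\<close> of the two sides
  at a vertex (with the discount extended linearly), projects to \<open>y1\<close> and \<open>y2\<close> on them and has squared
  distance \<open>z\<close> from the vertex. Completing the square in \<open>y1, y2\<close> moves the point
  to the centroid of what it serves and leaves a function of \<open>L = x1 + x2\<close> and \<open>P = x1 * x2\<close>, convex in
  \<open>P\<close>. So the extremes are \<open>P = 0\<close> (everything on one side), which is far from optimal, and the symmetric
  cell \<open>P = L^2/4\<close>, where the deficit is \<open>7/192 * (L - 2)^2 * (L + sqrt 7)\<close>.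
\<close>

lemma corner_cell_cost_estimate:
  fixes x1 x2 y1 y2 z :: real
  assumes x: "x1 > 0" "x2 > 0"
    and z: "z \<ge> 4/3 * (y1\<^sup>2 + y2\<^sup>2 - y1 * y2)"
  defines "G \<equiv> (7/16 - corner_slope - z) * (x1 + x2)
      + (y1 + corner_slope/2) * x1\<^sup>2 + (y2 + corner_slope/2) * x2\<^sup>2 - (x1^3 + x2^3) / 3"
  shows "G \<le> 7 * sqrt 7 / 48" (is ?le)
    and "G = 7 * sqrt 7 / 48 \<Longrightarrow> x1 = 1 \<and> x2 = 1 \<and> y1 = 3/8 \<and> y2 = 3/8 \<and> z = 3/16"
proof -
  define b where "b = corner_slope"
  define L where "L = x1 + x2"
  define P where "P = x1 * x2"
  have Lpos: "L > 0" and Ppos: "P > 0" using x by (auto simp: L_def P_def)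
  have PL: "P \<le> L\<^sup>2 / 4"
  proof -
    have "L\<^sup>2 - 4 * P = (x1 - x2)\<^sup>2" unfolding L_def P_def by algebra
    then show ?thesis using zero_le_power2[of "x1 - x2"] by linarith
  qed
  define e where "e = z - 4/3 * (y1\<^sup>2 + y2\<^sup>2 - y1 * y2)"
  \<comment> \<open>\<open>c1\<close> and \<open>c2\<close> vanish when the point is the centroid; \<open>e\<close> vanishes when it lies in the plane of the sides.\<close>
  define c1 where "c1 = 2 * L * y1 - (x1\<^sup>2 + x2\<^sup>2 / 2)"
  define c2 where "c2 = 2 * L * y2 - (x2\<^sup>2 + x1\<^sup>2 / 2)"
  define sq where "sq = (c1 - c2 / 2)\<^sup>2 + 3/4 * c2\<^sup>2"
  have sq: "sq \<ge> 0" by (simp add: sq_def)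
  define F where "F = (7/16 - b) * L + b * L\<^sup>2 / 2 - L^3 / 12 + 3/4 * P\<^sup>2 / L - b * P"
  have GF: "G = F - e * L - sq / (3 * L)"
  proof -
    have "12 * L * G = 12 * L * F - 12 * L * e * L - 4 * sq"
    proof -
      have "12 * L * F = 12 * L * ((7/16 - b) * L + b * L\<^sup>2 / 2 - L^3 / 12 - b * P) + 9 * P\<^sup>2"
        using Lpos by (simp add: F_def field_simps)
      then show ?thesis
        unfolding G_def e_def c1_def c2_def sq_def b_def[symmetric]
        unfolding L_def P_def by algebra
    qed
    then show ?thesis using Lpos by (simp add: field_simps)
  qed
  define C1 where "C1 = (7/16 - b) * L + b * L\<^sup>2 / 2 - L^3 / 12"
  have bb: "4937/25000 < b" "b < 19751/100000" using corner_slope_bounds by (auto simp: b_def)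
  have C1: "C1 < 77/200"
  proof -
    \<comment> \<open>Tangents near the maximum of the cubic \<open>C1\<close>, which is about \<open>0.30\<close>.\<close>
    have "(L - 3/2)\<^sup>2 * L \<ge> 0" using Lpos by simp
    then have cub: "L^3 \<ge> 3 * L\<^sup>2 - 9/4 * L"
      by (simp add: power2_eq_square power3_eq_cube algebra_simps)
    have "(L - 29/20)\<^sup>2 \<ge> 0" by simp
    then have sqr: "L\<^sup>2 \<ge> 29/10 * L - 841/400" by (simp add: power2_eq_square algebra_simps)
    have "b * L\<^sup>2 \<le> 19751/100000 * L\<^sup>2" using bb by (intro mult_right_mono) auto
    moreover have "(7/16 - b) * L \<le> 12001/50000 * L" using bb Lpos by (intro mult_right_mono) auto
    ultimately have "C1 \<le> 24002/100000 * L + 19751/200000 * L\<^sup>2 - (3 * L\<^sup>2 - 9/4 * L) / 12"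
      unfolding C1_def using cub by (simp add: field_simps)
    then show ?thesis using sqr Lpos by (simp add: field_simps)
  qed
  have lam: "7 * sqrt 7 / 48 > ((1929/5000)::real)" using sqrt7_bounds by simp
  \<comment> \<open>This is convexity in \<open>P\<close>: the chord over \<open>{0..L^2/4}\<close> lies above.\<close>
  have F1: "F \<le> C1 + P * (3 * L / 16 - b)"
  proof -
    have "P\<^sup>2 \<le> P * (L\<^sup>2 / 4)" using PL Ppos by (simp add: power2_eq_square)
    then have "P\<^sup>2 / L \<le> P * L / 4" using Lpos by (simp add: field_simps power2_eq_square)
    then show ?thesis unfolding F_def C1_def by (simp add: algebra_simps)
  qed
  have cubic: "C1 + L\<^sup>2 / 4 * (3 * L / 16 - b) = 7 * sqrt 7 / 48 - 7/192 * ((L - 2)\<^sup>2 * (L + sqrt 7))"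
    unfolding C1_def b_def corner_slope_def
    by (simp add: power2_eq_square power3_eq_cube field_simps)
  have cubic_nonneg: "(L - 2)\<^sup>2 * (L + sqrt 7) \<ge> 0" using Lpos by simp
  have F: "F \<le> 7 * sqrt 7 / 48"
  proof (cases "3 * L / 16 \<le> b")
    case True
    then have "P * (3 * L / 16 - b) \<le> 0" using Ppos by (simp add: mult_nonneg_nonpos)
    then show ?thesis using F1 C1 lam by linarith
  next
    case False
    then have "P * (3 * L / 16 - b) \<le> L\<^sup>2 / 4 * (3 * L / 16 - b)"
      using PL by (intro mult_right_mono) auto
    then show ?thesis using F1 cubic cubic_nonneg by linarith
  qed
  have e: "e * L \<ge> 0" and sqL: "sq / (3 * L) \<ge> 0" using z Lpos sq by (auto simp: e_def)
  show ?le using F GF e sqL by linarith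
  assume eq: "G = 7 * sqrt 7 / 48"
  then have "e * L = 0" "sq / (3 * L) = 0" and Feq: "F = 7 * sqrt 7 / 48"
    using F GF e sqL by linarith+
  then have "e = 0" "sq = 0" using Lpos by auto
  then have c: "c2 = 0" "c1 = 0"
    unfolding sq_def by (auto simp: add_nonneg_eq_0_iff)
  have big: "3 * L / 16 > b"
  proof (rule ccontr)
    assume "\<not> 3 * L / 16 > b"
    then have "P * (3 * L / 16 - b) \<le> 0" using Ppos by (simp add: mult_nonneg_nonpos)
    then show False using F1 C1 lam Feq by linarith
  qed
  then have le: "P * (3 * L / 16 - b) \<le> L\<^sup>2 / 4 * (3 * L / 16 - b)"
    using PL by (intro mult_right_mono) auto
  then have "(L - 2)\<^sup>2 * (L + sqrt 7) = 0" and eqP: "P * (3 * L / 16 - b) = L\<^sup>2 / 4 * (3 * L / 16 - b)"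
    using F1 cubic cubic_nonneg Feq by linarith+
  then have "L = 2 \<or> L + sqrt 7 = 0" by simp
  moreover have "L + sqrt 7 > 0" using Lpos by (simp add: add_pos_pos)
  ultimately have L2: "L = 2" by linarith
  then have "P = 1" using eqP big by simp
  then have "(x1 - x2)\<^sup>2 = 0" using L2 unfolding L_def P_def by algebra
  then have "x1 = 1" "x2 = 1" using L2 by (auto simp: L_def)
  moreover from this have "y1 = 3/8" "y2 = 3/8" using c by (auto simp: c1_def c2_def L_def)
  moreover from this have "e = z - 3/16"
    unfolding e_def \<open>y1 = 3/8\<close> \<open>y2 = 3/8\<close> by (simp add: power2_eq_square)
  then have "z = 3/16" using \<open>e = 0\<close> by simp
  ultimately show "x1 = 1 \<and> x2 = 1 \<and> y1 = 3/8 \<and> y2 = 3/8 \<and> z = 3/16" by simp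
qed

text \<open>
  The other way to serve both sides at a vertex leaves the vertex itself unserved. What is served is then
  two chords of a disc, with midpoints at distance \<open>m1, m2\<close> from the vertex and half-lengths \<open>h1, h2\<close>;
  \<open>t\<close> is the power of the vertex with respect to the disc, and a chord gains \<open>4/3 * h^3\<close>. The last
  hypothesis says how far the disc, whose radius is determined by the weight, is from the vertex. The worst case
  is the symmetric disc through the vertex, and it misses the bound by only about one percent, so the
  numerical constants below have to be fairly sharp.
\<close>

lemma two_chords_cost_estimate:
  fixes m1 m2 h1 h2 t :: real
  assumes nonneg: "m1 \<ge> 0" "m2 \<ge> 0" "h1 \<ge> 0" "h2 \<ge> 0" "t \<ge> 0"
    and power: "m1\<^sup>2 - h1\<^sup>2 = t" "m2\<^sup>2 - h2\<^sup>2 = t"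
    and z: "4/3 * (m1\<^sup>2 + m2\<^sup>2 - m1 * m2) - 2/3 * corner_slope * (m1 + m2) + corner_slope\<^sup>2 / 3
              \<le> t + 7/16 - corner_slope"
  shows "4/3 * (h1^3 + h2^3) < 7 * sqrt 7 / 48"
proof -
  define b where "b = corner_slope"
  have bb: "4937/25000 < b" "b < 19751/100000" using corner_slope_bounds by (auto simp: b_def)
  define s where "s = m1 + m2"
  define e where "e = (m1 - m2)\<^sup>2"
  define H where "H = h1\<^sup>2 + h2\<^sup>2"
  define g2 where "g2 = (h1\<^sup>2 - h2\<^sup>2)\<^sup>2"
  have s: "s \<ge> 0" and e: "e \<ge> 0" and H: "H \<ge> 0" using nonneg by (auto simp: s_def e_def H_def)
  have g2: "g2 = s\<^sup>2 * e"
  proof -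
    have "h1\<^sup>2 - h2\<^sup>2 = m1\<^sup>2 - m2\<^sup>2" using power by linarith
    then show ?thesis unfolding g2_def s_def e_def by algebra
  qed
  have g2H: "g2 \<le> H\<^sup>2"
  proof -
    have "H\<^sup>2 - g2 = 4 * (h1\<^sup>2 * h2\<^sup>2)" unfolding g2_def H_def by algebra
    moreover have "h1\<^sup>2 * h2\<^sup>2 \<ge> 0" by simp
    ultimately show ?thesis by linarith
  qed
  have tt: "4 * t = s\<^sup>2 + e - 2 * H"
  proof -
    have "s\<^sup>2 + e = 2 * (m1\<^sup>2 + m2\<^sup>2)" unfolding s_def e_def by algebra
    moreover have "4 * t = 2 * (m1\<^sup>2 - h1\<^sup>2) + 2 * (m2\<^sup>2 - h2\<^sup>2)"
      unfolding power by simp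
    ultimately show ?thesis unfolding H_def by (simp add: algebra_simps)
  qed
  have H2: "2 * H \<le> s\<^sup>2 + e" using tt nonneg by linarith
  define H0 where "H0 = 2 * (7/16 - b - b\<^sup>2/3) + 4/3 * b * s - s\<^sup>2 / 6"
  have HH: "H \<le> H0 - 3/2 * e"
  proof -
    have "m1\<^sup>2 + m2\<^sup>2 - m1 * m2 = (s\<^sup>2 + 3 * e) / 4" unfolding s_def e_def
      by (simp add: power2_eq_square field_simps)
    then show ?thesis using z tt unfolding H0_def b_def[symmetric] s_def[symmetric]
      by (simp add: field_simps)
  qed
  \<comment> \<open>The largest half-lengths are close to \<open>1/2\<close>, where this inequality is an equality.\<close>
  have cube: "x^3 \<le> x^4 + x\<^sup>2 / 4" for x :: real
  proof -
    have "x^4 + x\<^sup>2 / 4 - x^3 = (x * (x - 1/2))\<^sup>2"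
      by (simp add: power2_eq_square power3_eq_cube power4_eq_xxxx field_simps)
    then show ?thesis using zero_le_power2[of "x * (x - 1/2)"] by linarith
  qed
  have "h1^3 + h2^3 \<le> H\<^sup>2 / 2 + g2 / 2 + H / 4"
  proof -
    have "H\<^sup>2 / 2 + g2 / 2 = h1^4 + h2^4" unfolding H_def g2_def
      by (simp add: power2_eq_square power4_eq_xxxx field_simps)
    moreover have "H / 4 = h1\<^sup>2 / 4 + h2\<^sup>2 / 4" by (simp add: H_def)
    ultimately show ?thesis using cube[of h1] cube[of h2] by linarith
  qed
  moreover have "H\<^sup>2 / 2 + g2 / 2 + H / 4 < 2893/10000"
  proof (cases "H \<le> 21/50")
    case True
    then have "H\<^sup>2 \<le> (21/50)\<^sup>2" using H by (intro power_mono) auto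
    then have "H\<^sup>2 \<le> 441/2500" by (simp add: power2_eq_square)
    then show ?thesis using True g2H by linarith
  next
    case False
    have b2: "b\<^sup>2 \<ge> (4937/25000)\<^sup>2" using bb by (intro power_mono) auto
    have H0_le: "H0 \<le> 9081/20000 + 5267/20000 * s - s\<^sup>2 / 6"
    proof -
      have "4/3 * b * s \<le> 5267/20000 * s" using bb s by (intro mult_right_mono) auto
      then show ?thesis using b2 bb unfolding H0_def by (simp add: power2_eq_square)
    qed
    \<comment> \<open>\<open>H0\<close> is concave in \<open>s\<close>: it lies below its tangents.\<close>
    have tangent: "H0 \<le> 9081/20000 + 5267/20000 * s - u * s / 3 + u\<^sup>2 / 6" for u
    proof -
      have "(s - u)\<^sup>2 \<ge> 0" by simp
      then have "s\<^sup>2 \<ge> 2 * u * s - u\<^sup>2" by (simp add: power2_eq_square field_simps)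
      then show ?thesis using H0_le by linarith
    qed
    have HH0: "H \<le> H0" using HH e by linarith
    \<comment> \<open>Replaces the convex function \<open>H^2\<close> on \<open>{21/50..c}\<close> by its chord, so that the rest is linear.\<close>
    have conv: "H\<^sup>2 \<le> 21/50 * H + c * H - 21/50 * c" if "H \<le> c" for c
    proof -
      have "(H - 21/50) * (H - c) \<le> 0" using that False by (simp add: mult_nonneg_nonpos)
      then show ?thesis by (simp add: power2_eq_square field_simps)
    qed
    \<comment> \<open>For small \<open>s\<close> the vertex being outside the disc (\<open>H2\<close>) keeps \<open>H\<close> small, for larger \<open>s\<close> the decrease of \<open>H0\<close> does.\<close>
    consider "s \<le> 51/50" | "s > 51/50" "s\<^sup>2 \<le> 2" | "s\<^sup>2 > 2" by linarith
    then show ?thesis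
    proof cases
      case 1
      have s2: "s\<^sup>2 \<le> (51/50)\<^sup>2" using 1 s by (intro power_mono) auto
      have H0b: "H0 \<le> 349/625" using tangent[of "79/100"] 1 s by (simp add: power2_eq_square)
      have ee: "e \<le> 2/3 * H0 - 2/3 * H" using HH by linarith
      have "g2 \<le> 2601/2500 * e" unfolding g2 using s2 e by (intro mult_right_mono) (auto simp: power2_eq_square)
      moreover have "H \<le> 53/100" using H2 s2 ee H0b by (simp add: power2_eq_square)
      then have "H\<^sup>2 \<le> 21/50 * H + 53/100 * H - 21/50 * (53/100)" using conv[of "53/100"] by linarith
      ultimately show ?thesis using ee H0b False \<open>H \<le> 53/100\<close> by linarith
    next
      case 2
      have H0b: "H0 \<le> 1099/2000" using tangent[of "51/50"] 2 by (simp add: power2_eq_square)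
      have "g2 \<le> 2 * e" unfolding g2 using 2 e by (intro mult_right_mono) auto
      moreover have "H\<^sup>2 \<le> 21/50 * H + 1099/2000 * H - 21/50 * (1099/2000)" using conv[of "1099/2000"] HH0 H0b by linarith
      ultimately show ?thesis using HH H0b False e by linarith
    next
      case 3
      have s1: "s \<ge> 7071/5000"
      proof (rule ccontr)
        assume "\<not> s \<ge> 7071/5000"
        then have "s\<^sup>2 \<le> (7071/5000)\<^sup>2" using s by (intro power_mono) auto
        then show False using 3 by (simp add: power2_eq_square)
      qed
      have H0b: "H0 \<le> 2467/5000" using tangent[of "7071/5000"] s1 by (simp add: power2_eq_square)
      have "s \<le> 173/100"
        using tangent[of "171/100"] HH0 False by (simp add: power2_eq_square)
      then have "s\<^sup>2 \<le> (173/100)\<^sup>2" using s by (intro power_mono) auto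
      then have "g2 \<le> 3 * e" unfolding g2 using e by (intro mult_right_mono) (auto simp: power2_eq_square)
      moreover have "H\<^sup>2 \<le> 21/50 * H + 2467/5000 * H - 21/50 * (2467/5000)" using conv[of "2467/5000"] HH0 H0b by linarith
      ultimately show ?thesis using HH H0b False e by linarith
    qed
  qed
  ultimately show ?thesis using sqrt7_bounds by simp
qed

section \<open>The gain of a point along one side\<close>

text \<open>
  The weight that a boundary point at distance \<open>s\<close> from one end of its unit side offers for being
  served. In the middle of the side it is the square of half a cell length, \<open>(sqrt 7 / 4 * r)^2\<close>, so that
  a weight is used up exactly at the ends of a cell. The discount near the vertices accounts for the
  corner points serving two sides at once.
\<close>

definition dual_weight :: "real \<Rightarrow> real \<Rightarrow> real" where
  "dual_weight r s = 7/16 * r\<^sup>2 - corner_slope * r * (max 0 (r - s) + max 0 (r - (1 - s)))"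

text \<open>
  What a point gains on one side: it collects the weights and pays the squared distances, and it serves
  only where this is profitable. The point enters through its projection \<open>u\<close> on the side and its squared
  distance \<open>z\<close> from the end where \<open>s = 0\<close>.
\<close>

definition side_gain :: "real \<Rightarrow> real \<Rightarrow> real \<Rightarrow> real" where
  "side_gain r u z = integral {0..1} (\<lambda>s. max 0 (dual_weight r s - (s\<^sup>2 - 2 * u * s + z)))"

text \<open>
  The gain of the midpoint of a full cell of length \<open>sqrt 7 / 2 * r\<close>.
\<close>

definition point_price :: "real \<Rightarrow> real" where
  "point_price r = 7 * sqrt 7 / 48 * r^3"

lemma corner_slope_pos: "corner_slope > 0"
  using corner_slope_bounds by simp

lemma point_price_pos: "r > 0 \<Longrightarrow> point_price r > 0"
  by (simp add: point_price_def)

lemma continuous_on_dual_weight [continuous_intros]: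
  "continuous_on S f \<Longrightarrow> continuous_on S (\<lambda>x. dual_weight r (f x))"
  unfolding dual_weight_def by (intro continuous_intros)

lemma dual_weight_reflect: "dual_weight r (1 - s) = dual_weight r s"
  by (simp add: dual_weight_def)

lemma dual_weight_le: "r \<ge> 0 \<Longrightarrow> dual_weight r s \<le> 7/16 * r\<^sup>2"
  using corner_slope_pos by (simp add: dual_weight_def)

lemma dual_weight_le_affine:
  assumes "r \<ge> 0"
  shows "dual_weight r s \<le> 7/16 * r\<^sup>2 - corner_slope * r * (r - s)"
proof -
  have "corner_slope * r * (r - s) \<le> corner_slope * r * (max 0 (r - s) + max 0 (r - (1 - s)))"
    using assms corner_slope_pos by (intro mult_left_mono) auto
  then show ?thesis by (simp add: dual_weight_def)
qed

lemma integral_quadratic: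
  fixes a b p q :: real
  assumes "a \<le> b"
  shows "integral {a..b} (\<lambda>s. p + q * s - s\<^sup>2)
    = p * (b - a) + q * (b\<^sup>2 - a\<^sup>2) / 2 - (b^3 - a^3) / 3"
proof -
  have "((\<lambda>s. p + q * s - s\<^sup>2) has_integral
      (p * b + q * b\<^sup>2 / 2 - b^3 / 3) - (p * a + q * a\<^sup>2 / 2 - a^3 / 3)) {a..b}"
    using assms
    by (intro fundamental_theorem_of_calculus)
       (auto intro!: derivative_eq_intros simp flip: has_real_derivative_iff_has_vector_derivative)
  then show ?thesis by (simp add: integral_unique field_simps)
qed

lemma integral_reflect_unit: "integral {0..1} (\<lambda>s. f (1 - s)) = integral {0..1::real} (f :: real \<Rightarrow> real)"
proof -
  have "integral {0..1} f = integral {-1..0} (\<lambda>s. f (s + 1))"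
    using integral_shift_real_ivl[of 0 1 1 f] by simp
  also have "\<dots> = integral {0..1} (\<lambda>s. f (1 - s))"
    using Henstock_Kurzweil_Integration.integral_reflect_real[of 1 0 "\<lambda>s. f (1 - s)"] by (simp add: add.commute)
  finally show ?thesis by simp
qed

text \<open>
  Positive parts are never integrated exactly: it suffices to know an interval outside which the
  integrand is not positive, and a majorant on that interval. The interval may stick out of
  \<open>{0..1}\<close>, which is why the majorant must be nonnegative.
\<close>

lemma integral_pos_part_le:
  fixes f g :: "real \<Rightarrow> real"
  assumes f: "continuous_on {0..1} f" and g: "continuous_on {a..b} g"
    and nonneg: "\<And>s. s \<in> {a..b} \<Longrightarrow> 0 \<le> g s"
    and le: "\<And>s. s \<in> {0..1} \<Longrightarrow> s \<in> {a..b} \<Longrightarrow> f s \<le> g s"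
    and out: "\<And>s. s \<in> {0..1} \<Longrightarrow> s \<notin> {a..b} \<Longrightarrow> f s \<le> 0"
  shows "integral {0..1} (\<lambda>s. max 0 (f s)) \<le> integral {a..b} g"
proof -
  have sub: "{a..b} \<inter> {0..1} = {max a 0..min b 1}" by auto
  have int: "g integrable_on {max a 0..min b 1}"
    by (intro integrable_continuous_real continuous_on_subset[OF g]) auto
  have "integral {0..1} (\<lambda>s. max 0 (f s)) \<le> integral {0..1} (\<lambda>s. if s \<in> {a..b} then g s else 0)"
  proof (rule integral_le)
    show "(\<lambda>s. max 0 (f s)) integrable_on {0..1}"
      by (intro integrable_continuous_real continuous_intros f)
    show "(\<lambda>s. if s \<in> {a..b} then g s else 0) integrable_on {0..1}"
      using int unfolding Henstock_Kurzweil_Integration.integrable_restrict_Int sub .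
  qed (use nonneg le out in force)
  also have "\<dots> = integral {max a 0..min b 1} g"
    unfolding Henstock_Kurzweil_Integration.integral_restrict_Int sub ..
  also have "\<dots> \<le> integral {a..b} g"
    by (rule integral_subset_le) (use nonneg int integrable_continuous_real[OF g] in auto)
  finally show ?thesis .
qed

lemma side_gain_nonneg: "side_gain r u z \<ge> 0"
  unfolding side_gain_def
  by (rule integral_nonneg) (auto intro!: integrable_continuous_real continuous_intros)

lemma side_gain_reflect: "side_gain r (1 - u) (z - 2 * u + 1) = side_gain r u z"
proof -
  have eq: "dual_weight r (1 - s) - ((1 - s)\<^sup>2 - 2 * (1 - u) * (1 - s) + (z - 2 * u + 1))
      = dual_weight r s - (s\<^sup>2 - 2 * u * s + z)" for s
    unfolding dual_weight_reflect by (simp add: power2_eq_square algebra_simps)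
  show ?thesis
    using integral_reflect_unit[of "\<lambda>s. max 0 (dual_weight r s - (s\<^sup>2 - 2 * (1 - u) * s + (z - 2 * u + 1)))"]
    unfolding side_gain_def eq by (rule sym)
qed

lemma integral_parabola_cap:
  fixes h u :: real
  assumes "h \<ge> 0"
  shows "integral {u - h..u + h} (\<lambda>s. h\<^sup>2 - (s - u)\<^sup>2) = 4/3 * h^3"
proof -
  have "(\<lambda>s. h\<^sup>2 - (s - u)\<^sup>2) = (\<lambda>s. (h\<^sup>2 - u\<^sup>2) + 2 * u * s - s\<^sup>2)"
    by (simp add: fun_eq_iff power2_eq_square algebra_simps)
  then have "integral {u - h..u + h} (\<lambda>s. h\<^sup>2 - (s - u)\<^sup>2)
      = integral {u - h..u + h} (\<lambda>s. (h\<^sup>2 - u\<^sup>2) + 2 * u * s - s\<^sup>2)" by (simp only:)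
  also have "\<dots> = (h\<^sup>2 - u\<^sup>2) * (u + h - (u - h)) + 2 * u * ((u + h)\<^sup>2 - (u - h)\<^sup>2) / 2
      - ((u + h)^3 - (u - h)^3) / 3"
    using assms by (intro integral_quadratic) simp
  also have "\<dots> = 4/3 * h^3" by (simp add: power2_eq_square power3_eq_cube field_simps)
  finally show ?thesis .
qed

lemma in_cap_iff: "h \<ge> 0 \<Longrightarrow> s \<in> {u - h..u + h} \<longleftrightarrow> (s - u)\<^sup>2 \<le> h\<^sup>2" for h s u :: real
  by (subst abs_le_square_iff[symmetric]) auto

lemma side_gain_le_cap:
  assumes "h \<ge> 0"
    and "\<And>s. s \<in> {0..1} \<Longrightarrow> dual_weight r s - (s\<^sup>2 - 2 * u * s + z) \<le> h\<^sup>2 - (s - m)\<^sup>2"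
  shows "side_gain r u z \<le> 4/3 * h^3"
proof -
  have "side_gain r u z \<le> integral {m - h..m + h} (\<lambda>s. h\<^sup>2 - (s - m)\<^sup>2)"
    unfolding side_gain_def
  proof (rule integral_pos_part_le)
    fix s :: real assume "s \<in> {0..1}" "s \<notin> {m - h..m + h}"
    then show "dual_weight r s - (s\<^sup>2 - 2 * u * s + z) \<le> 0"
      using assms in_cap_iff[of h s m] by (smt (verit))
  next
    fix s :: real assume "s \<in> {m - h..m + h}"
    then show "0 \<le> h\<^sup>2 - (s - m)\<^sup>2" using in_cap_iff[OF assms(1)] by simp
  qed (intro continuous_intros assms(2), assumption?)+
  then show ?thesis using assms by (simp add: integral_parabola_cap)
qed

lemma side_gain_le_dist:
  assumes r: "r \<ge> 0" and h: "h \<ge> 0" "7/16 * r\<^sup>2 - (z - u\<^sup>2) \<le> h\<^sup>2"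
  shows "side_gain r u z \<le> 4/3 * h^3"
proof (rule side_gain_le_cap[OF h(1)])
  fix s :: real
  have "dual_weight r s - (s\<^sup>2 - 2 * u * s + z) \<le> 7/16 * r\<^sup>2 - (z - u\<^sup>2) - (s - u)\<^sup>2"
    using dual_weight_le[OF r, of s] by (simp add: power2_eq_square algebra_simps)
  then show "dual_weight r s - (s\<^sup>2 - 2 * u * s + z) \<le> h\<^sup>2 - (s - u)\<^sup>2"
    using h by linarith
qed

lemma half_cell_square: "(sqrt 7 / 4 * r)\<^sup>2 = 7/16 * r\<^sup>2"
  by (simp add: power_mult_distrib power_divide)

lemma half_cell_cube: "4/3 * (sqrt 7 / 4 * r)^3 = point_price r"
  by (simp add: point_price_def power_mult_distrib power_divide power3_eq_cube)

lemma side_gain_eq_0: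
  assumes "r \<ge> 0" "z - u\<^sup>2 \<ge> 7/16 * r\<^sup>2"
  shows "side_gain r u z = 0"
  using side_gain_le_dist[of r 0 z u] assms side_gain_nonneg[of r u z] by simp

lemma side_gain_le_price:
  assumes "r \<ge> 0" "u\<^sup>2 \<le> z"
  shows "side_gain r u z \<le> point_price r"
  using side_gain_le_dist[of r "sqrt 7 / 4 * r" z u] assms half_cell_square[of r]
    half_cell_cube[of r] by simp

text \<open>
  A point that attains the price on one side must lose nothing against the full parabola of a cell:
  it lies on the side, and its cell stays clear of the discount at \<open>s = 0\<close>. For the second part, a cell
  that reached into the discounted range would lose a positive amount on an interval.
\<close>

lemma side_gain_eq_price_lower:
  assumes r: "r > 0" and z: "u\<^sup>2 \<le> z" and eq: "side_gain r u z = point_price r"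
  shows "z = u\<^sup>2 \<and> r + sqrt 7 / 4 * r \<le> u"
proof (rule ccontr)
  assume contra: "\<not> (z = u\<^sup>2 \<and> r + sqrt 7 / 4 * r \<le> u)"
  define h where "h = sqrt 7 / 4 * r"
  have h: "h > 0" "h\<^sup>2 = 7/16 * r\<^sup>2" "4/3 * h^3 = point_price r"
    using r half_cell_square half_cell_cube by (auto simp: h_def)
  show False
  proof (cases "z = u\<^sup>2")
    case False
    define h' where "h' = sqrt (max 0 (h\<^sup>2 - (z - u\<^sup>2)))"
    have h': "h' \<ge> 0" "h'\<^sup>2 = max 0 (h\<^sup>2 - (z - u\<^sup>2))" by (auto simp: h'_def)
    have "h'\<^sup>2 < h\<^sup>2" unfolding h'(2) using False z h(1) by simp
    then have "h' < h" using h(1) power2_less_imp_less[of h' h] by simp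
    then have "h'^3 < h^3" using h' by (intro power_strict_mono) auto
    moreover have "side_gain r u z \<le> 4/3 * h'^3"
      using h h' r by (intro side_gain_le_dist) auto
    ultimately show False using eq h by simp
  next
    case True
    then have u: "u - h < r" using contra h_def by linarith
    define g where "g = (\<lambda>s. h\<^sup>2 - (s - u)\<^sup>2)"
    define f where "f = (\<lambda>s. g s - corner_slope * r * max 0 (r - s))"
    define a where "a = max 0 (u - h)"
    define b where "b = u + h"
    have fg: "f s \<le> g s" for s
      using corner_slope_pos r by (simp add: f_def)
    have df: "dual_weight r s - (s\<^sup>2 - 2 * u * s + z) \<le> f s" for s
    proof -
      have "dual_weight r s \<le> h\<^sup>2 - corner_slope * r * max 0 (r - s)"
        using corner_slope_pos r by (simp add: dual_weight_def h(2) mult_left_mono)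
      then show ?thesis using True by (simp add: f_def g_def power2_eq_square algebra_simps)
    qed
    have gpos: "g s \<ge> 0 \<longleftrightarrow> s \<in> {u - h..u + h}" for s
      using in_cap_iff[of h s u] h(1) by (simp add: g_def)
    have le: "side_gain r u z \<le> integral {a..b} (\<lambda>s. max 0 (f s))"
      unfolding side_gain_def
    proof (rule integral_pos_part_le)
      fix s :: real assume s: "s \<in> {0..1}" "s \<notin> {a..b}"
      then have "\<not> g s \<ge> 0" using gpos[of s] by (auto simp: a_def b_def)
      then show "dual_weight r s - (s\<^sup>2 - 2 * u * s + z) \<le> 0"
        using df[of s] corner_slope_pos r unfolding f_def
        by (smt (verit) mult_nonneg_nonneg)
    next
      fix s :: real
      show "dual_weight r s - (s\<^sup>2 - 2 * u * s + z) \<le> max 0 (f s)" using df[of s] by simp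
    qed (auto intro!: continuous_intros simp: f_def g_def)
    show False
    proof (cases "b \<le> 0")
      case True
      then have "b \<le> a" by (simp add: a_def)
      then have "integral {a..b} (\<lambda>s. max 0 (f s)) = 0"
        by (cases "a = b") auto
      then show False using le eq point_price_pos[OF r] by simp
    next
      case False
      define D where "D = (\<lambda>s. g s - max 0 (f s))"
      have ab: "a < b" using False h by (simp add: a_def b_def)
      have contD: "continuous_on {a..b} D" and contg: "continuous_on X g"
        and contf: "continuous_on X (\<lambda>s. max 0 (f s))" for X
        unfolding D_def f_def g_def by (auto intro!: continuous_intros)
      have Dnn: "D s \<ge> 0" if "s \<in> {a..b}" for s
        using that gpos[of s] fg[of s] by (auto simp: D_def a_def b_def)
      have "integral {a..b} D \<noteq> 0"
      proof
        assume "integral {a..b} D = 0"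
        then have zero: "\<forall>s\<in>{a..b}. D s = 0"
          using integral_cbox_eq_0_iff[of a b D] contD Dnn ab by simp
        \<comment> \<open>A point inside the cell that is still in the discounted range.\<close>
        define s where "s = (a + min r b) / 2"
        have s: "a < s" "s < r" "s < b" using ab u r by (auto simp: s_def a_def min_def)
        have "\<bar>s - u\<bar> < h" using s by (auto simp: a_def b_def)
        then have "\<bar>s - u\<bar>\<^sup>2 < h\<^sup>2" by (intro power_strict_mono) auto
        then have "(s - u)\<^sup>2 < h\<^sup>2" by simp
        then have "g s > 0" by (simp add: g_def)
        moreover have "f s < g s" using s corner_slope_pos r by (simp add: f_def)
        ultimately have "D s > 0" by (simp add: D_def)
        then show False using zero s by auto
      qed
      moreover have "integral {a..b} D \<ge> 0"
        using Dnn by (intro integral_nonneg integrable_continuous_real contD) auto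
      moreover have "integral {a..b} D = integral {a..b} g - integral {a..b} (\<lambda>s. max 0 (f s))"
        unfolding D_def by (intro Henstock_Kurzweil_Integration.integral_diff integrable_continuous_real contg contf)
      moreover have "integral {a..b} g \<le> integral {u - h..u + h} g"
        using gpos by (intro integral_subset_le integrable_continuous_real contg) (auto simp: a_def b_def)
      moreover have "integral {u - h..u + h} g = point_price r"
        using integral_parabola_cap[of h u] h(1,3) unfolding g_def by simp
      ultimately show False using le eq by linarith
    qed
  qed
qed

lemma side_gain_eq_price:
  assumes "r > 0" "u\<^sup>2 \<le> z" and eq: "side_gain r u z = point_price r"
  shows "z = u\<^sup>2" "u \<in> {r + sqrt 7 / 4 * r .. 1 - r - sqrt 7 / 4 * r}"
proof -
  have "(1 - u)\<^sup>2 \<le> z - 2 * u + 1" using assms by (simp add: power2_eq_square algebra_simps)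
  then have "r + sqrt 7 / 4 * r \<le> 1 - u"
    using side_gain_eq_price_lower[of r "1 - u" "z - 2 * u + 1"] assms side_gain_reflect by simp
  then show "z = u\<^sup>2" "u \<in> {r + sqrt 7 / 4 * r .. 1 - r - sqrt 7 / 4 * r}"
    using side_gain_eq_price_lower[of r u z] assms by auto
qed

text \<open>
  If the vertex is worth serving, then the point serves the side from the vertex up to the positive root
  \<open>b\<close> of its net weight, where the discount is replaced by its linear extension.
\<close>

lemma side_gain_le_from_vertex:
  assumes r: "r > 0" and z: "z < 7/16 * r\<^sup>2 - corner_slope * r\<^sup>2"
  obtains b where "b > 0" "side_gain r u z
    \<le> (7/16 * r\<^sup>2 - corner_slope * r\<^sup>2 - z) * b + (u + corner_slope * r / 2) * b\<^sup>2 - b^3 / 3"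
proof -
  define p where "p = 7/16 * r\<^sup>2 - corner_slope * r\<^sup>2 - z"
  define m where "m = u + corner_slope * r / 2"
  define b where "b = m + sqrt (m\<^sup>2 + p)"
  define b' where "b' = sqrt (m\<^sup>2 + p) - m"
  have p: "p > 0" using z by (simp add: p_def)
  have "\<bar>m\<bar> < sqrt (m\<^sup>2 + p)" using p by (intro real_less_rsqrt) auto
  then have b: "b > 0" "b' > 0" by (auto simp: b_def b'_def)
  have fact: "p + 2 * m * s - s\<^sup>2 = (b - s) * (b' + s)" for s
  proof -
    have "(sqrt (m\<^sup>2 + p))\<^sup>2 = m\<^sup>2 + p" using p by simp
    then show ?thesis unfolding b_def b'_def by algebra
  qed
  have "side_gain r u z \<le> integral {0..b} (\<lambda>s. p + 2 * m * s - s\<^sup>2)"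
    unfolding side_gain_def
  proof (rule integral_pos_part_le)
    fix s :: real assume s: "s \<in> {0..1}"
    have le: "dual_weight r s - (s\<^sup>2 - 2 * u * s + z) \<le> p + 2 * m * s - s\<^sup>2"
      using dual_weight_le_affine[of r s] r
      by (simp add: p_def m_def power2_eq_square algebra_simps)
    show "dual_weight r s - (s\<^sup>2 - 2 * u * s + z) \<le> p + 2 * m * s - s\<^sup>2" by fact
    assume "s \<notin> {0..b}"
    then have "(b - s) * (b' + s) \<le> 0" using s b by (intro mult_nonpos_nonneg) auto
    then show "dual_weight r s - (s\<^sup>2 - 2 * u * s + z) \<le> 0" using le fact by simp
  next
    fix s :: real assume "s \<in> {0..b}"
    then show "0 \<le> p + 2 * m * s - s\<^sup>2" unfolding fact using b by auto
  qed (auto intro!: continuous_intros)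
  also have "\<dots> = p * b + m * b\<^sup>2 - b^3 / 3"
    using b by (simp add: integral_quadratic)
  finally show ?thesis using that b(1) unfolding p_def m_def by blast
qed

text \<open>
  If the vertex is not worth serving, then the part of the side that is served lies inside a chord of
  the disc around the shifted point (the linear discount amounts to a shift of the centre).
\<close>

lemma side_gain_le_chord:
  assumes r: "r > 0" and z: "z \<ge> 7/16 * r\<^sup>2 - corner_slope * r\<^sup>2"
    and pos: "side_gain r u z > 0"
  obtains h where "h \<ge> 0" "u + corner_slope * r / 2 \<ge> 0"
    "h\<^sup>2 = (u + corner_slope * r / 2)\<^sup>2 - (z - 7/16 * r\<^sup>2 + corner_slope * r\<^sup>2)"
    "side_gain r u z \<le> 4/3 * h^3"
proof -
  define t where "t = z - 7/16 * r\<^sup>2 + corner_slope * r\<^sup>2"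
  define m where "m = u + corner_slope * r / 2"
  have t: "t \<ge> 0" using z by (simp add: t_def)
  have le: "dual_weight r s - (s\<^sup>2 - 2 * u * s + z) \<le> 2 * m * s - t - s\<^sup>2" for s
    using dual_weight_le_affine[of r s] r
    by (simp add: t_def m_def power2_eq_square algebra_simps)
  have zero: "side_gain r u z \<le> 0" if "\<And>s. s \<in> {0..1} \<Longrightarrow> 2 * m * s - t - s\<^sup>2 \<le> 0"
  proof -
    have "side_gain r u z = integral {0..1} (\<lambda>s::real. 0)"
      unfolding side_gain_def
    proof (rule Henstock_Kurzweil_Integration.integral_cong)
      fix s :: real assume "s \<in> {0..1}"
      then show "max 0 (dual_weight r s - (s\<^sup>2 - 2 * u * s + z)) = 0"
        using le[of s] that[of s] by linarith
    qed
    then show ?thesis by simp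
  qed
  have m: "m \<ge> 0"
  proof (rule ccontr)
    assume "\<not> m \<ge> 0"
    have "2 * m * s - t - s\<^sup>2 \<le> 0" if "s \<in> {0..1}" for s
    proof -
      have "m * s \<le> 0" using \<open>\<not> m \<ge> 0\<close> that by (simp add: mult_nonpos_nonneg)
      then show ?thesis using t zero_le_power2[of s] by linarith
    qed
    then have "side_gain r u z \<le> 0" by (rule zero)
    then show False using pos by simp
  qed
  have disc: "m\<^sup>2 - t \<ge> 0"
  proof (rule ccontr)
    assume "\<not> m\<^sup>2 - t \<ge> 0"
    have "2 * m * s - t - s\<^sup>2 \<le> 0" for s
    proof -
      have "2 * m * s - t - s\<^sup>2 = (m\<^sup>2 - t) - (s - m)\<^sup>2"
        by (simp add: power2_eq_square algebra_simps)
      then show ?thesis using \<open>\<not> m\<^sup>2 - t \<ge> 0\<close> zero_le_power2[of "s - m"] by linarith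
    qed
    then have "side_gain r u z \<le> 0" by (rule zero)
    then show False using pos by simp
  qed
  define h where "h = sqrt (m\<^sup>2 - t)"
  have h: "h \<ge> 0" "h\<^sup>2 = m\<^sup>2 - t" using disc by (auto simp: h_def)
  have "side_gain r u z \<le> 4/3 * h^3"
  proof (rule side_gain_le_cap[OF h(1)])
    fix s
    have "2 * m * s - t - s\<^sup>2 = h\<^sup>2 - (s - m)\<^sup>2"
      unfolding h by (simp add: power2_eq_square algebra_simps)
    then show "dual_weight r s - (s\<^sup>2 - 2 * u * s + z) \<le> h\<^sup>2 - (s - m)\<^sup>2" using le[of s] by simp
  qed
  then show ?thesis using that h m unfolding m_def t_def by blast
qed

section \<open>The gain of a point near a vertex\<close>

text \<open>
  The heart of the matter: on the two sides at a vertex together, a point gains at most the price, and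
  the only way to gain it by serving both is the corner point. The hypothesis on \<open>z\<close> says that the point
  is at least as far from the vertex as its projection to the plane of two unit vectors at an angle of 60
  degrees. The proof is by scaling to \<open>r = 1\<close> and distinguishing whether the vertex is worth serving.
\<close>

lemma corner_gain:
  assumes r: "r > 0" and z: "4/3 * (u1\<^sup>2 + u2\<^sup>2 - u1 * u2) \<le> z"
  shows corner_gain_le: "side_gain r u1 z + side_gain r u2 z \<le> point_price r"
    and corner_gain_eq: "side_gain r u1 z + side_gain r u2 z = point_price r \<Longrightarrow>
      u1 = 3/8 * r \<and> u2 = 3/8 * r \<and> z = 3/16 * r\<^sup>2
      \<or> side_gain r u1 z = point_price r \<or> side_gain r u2 z = point_price r"
proof -
  let ?G = "side_gain r u1 z + side_gain r u2 z"
  let ?C = "u1 = 3/8 * r \<and> u2 = 3/8 * r \<and> z = 3/16 * r\<^sup>2"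
  have uz: "u1\<^sup>2 \<le> z" "u2\<^sup>2 \<le> z"
  proof -
    have "4/3 * (u1\<^sup>2 + u2\<^sup>2 - u1 * u2) - u1\<^sup>2 = (u1 - 2 * u2)\<^sup>2 / 3"
      "4/3 * (u1\<^sup>2 + u2\<^sup>2 - u1 * u2) - u2\<^sup>2 = (u2 - 2 * u1)\<^sup>2 / 3"
      by (simp_all add: power2_eq_square field_simps)
    moreover have "(u1 - 2 * u2)\<^sup>2 / 3 \<ge> 0" "(u2 - 2 * u1)\<^sup>2 / 3 \<ge> 0" by simp_all
    ultimately show "u1\<^sup>2 \<le> z" "u2\<^sup>2 \<le> z" using z by linarith+
  qed
  define y1 where "y1 = u1 / r"
  define y2 where "y2 = u2 / r"
  define y where "y = z / r\<^sup>2"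
  have scale: "u1 = r * y1" "u2 = r * y2" "z = r\<^sup>2 * y" using r by (auto simp: y1_def y2_def y_def)
  have y: "4/3 * (y1\<^sup>2 + y2\<^sup>2 - y1 * y2) \<le> y"
  proof -
    have "r\<^sup>2 * (4/3 * (y1\<^sup>2 + y2\<^sup>2 - y1 * y2)) \<le> r\<^sup>2 * y"
      using z unfolding scale by (simp add: power2_eq_square algebra_simps)
    then show ?thesis using r by simp
  qed
  have "?G \<le> point_price r \<and> (?G = point_price r \<longrightarrow>
      ?C \<or> side_gain r u1 z = point_price r \<or> side_gain r u2 z = point_price r)"
  proof (cases "z < 7/16 * r\<^sup>2 - corner_slope * r\<^sup>2")
    case True
    obtain b1 where b1: "b1 > 0" "side_gain r u1 z
      \<le> (7/16 * r\<^sup>2 - corner_slope * r\<^sup>2 - z) * b1 + (u1 + corner_slope * r / 2) * b1\<^sup>2 - b1^3 / 3"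
      using side_gain_le_from_vertex[OF r True] by blast
    obtain b2 where b2: "b2 > 0" "side_gain r u2 z
      \<le> (7/16 * r\<^sup>2 - corner_slope * r\<^sup>2 - z) * b2 + (u2 + corner_slope * r / 2) * b2\<^sup>2 - b2^3 / 3"
      using side_gain_le_from_vertex[OF r True] by blast
    define x1 where "x1 = b1 / r"
    define x2 where "x2 = b2 / r"
    have x: "x1 > 0" "x2 > 0" and bx: "b1 = r * x1" "b2 = r * x2"
      using r b1 b2 by (auto simp: x1_def x2_def)
    define F where "F = (7/16 - corner_slope - y) * (x1 + x2)
      + (y1 + corner_slope/2) * x1\<^sup>2 + (y2 + corner_slope/2) * x2\<^sup>2 - (x1^3 + x2^3) / 3"
    have G: "?G \<le> r^3 * F"
    proof -
      have "r^3 * F = ((7/16 * r\<^sup>2 - corner_slope * r\<^sup>2 - z) * b1 + (u1 + corner_slope * r / 2) * b1\<^sup>2 - b1^3 / 3)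
         + ((7/16 * r\<^sup>2 - corner_slope * r\<^sup>2 - z) * b2 + (u2 + corner_slope * r / 2) * b2\<^sup>2 - b2^3 / 3)"
        unfolding F_def bx scale by (simp add: power2_eq_square power3_eq_cube field_simps)
      then show ?thesis using b1 b2 by linarith
    qed
    have r3: "r^3 > 0" using r by simp
    have F: "F \<le> 7 * sqrt 7 / 48"
      and Feq: "F = 7 * sqrt 7 / 48 \<Longrightarrow> x1 = 1 \<and> x2 = 1 \<and> y1 = 3/8 \<and> y2 = 3/8 \<and> y = 3/16"
      using corner_cell_cost_estimate[OF x y] unfolding F_def by blast+
    have le: "r^3 * F \<le> point_price r"
      using mult_left_mono[OF F, of "r^3"] r3 by (simp add: point_price_def mult.commute)
    moreover have ?C if "?G = point_price r"
    proof -
      have "r^3 * F = r^3 * (7 * sqrt 7 / 48)"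
        using that G le unfolding point_price_def by (simp only: mult.commute[of _ "r^3"])
      then have "F = 7 * sqrt 7 / 48" using r3 by simp
      then show ?thesis using Feq scale by simp
    qed
    ultimately show ?thesis using G by auto
  next
    case False
    then have t: "z \<ge> 7/16 * r\<^sup>2 - corner_slope * r\<^sup>2" by simp
    consider "side_gain r u1 z = 0" | "side_gain r u2 z = 0"
      | "side_gain r u1 z > 0" "side_gain r u2 z > 0"
      using side_gain_nonneg[of r] by (metis less_eq_real_def)
    then show ?thesis
    proof cases
      case 1 then show ?thesis using side_gain_le_price[of r u2 z] r uz by simp
    next
      case 2 then show ?thesis using side_gain_le_price[of r u1 z] r uz by simp
    next
      case 3
      obtain h1 where h1: "h1 \<ge> 0" "u1 + corner_slope * r / 2 \<ge> 0"
        "h1\<^sup>2 = (u1 + corner_slope * r / 2)\<^sup>2 - (z - 7/16 * r\<^sup>2 + corner_slope * r\<^sup>2)"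
        "side_gain r u1 z \<le> 4/3 * h1^3"
        using side_gain_le_chord[OF r t 3(1)] by blast
      obtain h2 where h2: "h2 \<ge> 0" "u2 + corner_slope * r / 2 \<ge> 0"
        "h2\<^sup>2 = (u2 + corner_slope * r / 2)\<^sup>2 - (z - 7/16 * r\<^sup>2 + corner_slope * r\<^sup>2)"
        "side_gain r u2 z \<le> 4/3 * h2^3"
        using side_gain_le_chord[OF r t 3(2)] by blast
      define c where "c = corner_slope"
      define k1 where "k1 = h1 / r"
      define k2 where "k2 = h2 / r"
      have k: "k1 \<ge> 0" "k2 \<ge> 0" and hk: "h1 = r * k1" "h2 = r * k2"
        using r h1 h2 by (auto simp: k1_def k2_def)
      have r2: "r\<^sup>2 > 0" using r by simp
      have eq: "r\<^sup>2 * ((v + c/2)\<^sup>2 - k\<^sup>2) - r\<^sup>2 * (y - 7/16 + c)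
          = (r * v + c * r / 2)\<^sup>2 - (r\<^sup>2 * y - 7/16 * r\<^sup>2 + c * r\<^sup>2) - (r * k)\<^sup>2" for v k
        by (simp add: power2_eq_square field_simps)
      have "4/3 * (k1^3 + k2^3) < 7 * sqrt 7 / 48"
      proof (rule two_chords_cost_estimate[where t = "y - 7/16 + c" and ?m1.0 = "y1 + c/2" and ?m2.0 = "y2 + c/2"])
        have "r * (y1 + c/2) \<ge> 0" "r * (y2 + c/2) \<ge> 0"
          using h1(2) h2(2) unfolding scale c_def by (simp_all add: algebra_simps)
        then show "y1 + c/2 \<ge> 0" "y2 + c/2 \<ge> 0" using r by (simp_all add: zero_le_mult_iff)
        have "r\<^sup>2 * (y - 7/16 + c) \<ge> 0" using t unfolding scale c_def by (simp add: algebra_simps)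
        then show "y - 7/16 + c \<ge> 0" using r2 by (simp add: zero_le_mult_iff)
        have "r\<^sup>2 * ((y1 + c/2)\<^sup>2 - k1\<^sup>2) = r\<^sup>2 * (y - 7/16 + c)"
          using h1(3) eq[of y1 k1] unfolding scale hk c_def[symmetric] by simp
        then show "(y1 + c/2)\<^sup>2 - k1\<^sup>2 = y - 7/16 + c" using r2 by simp
        have "r\<^sup>2 * ((y2 + c/2)\<^sup>2 - k2\<^sup>2) = r\<^sup>2 * (y - 7/16 + c)"
          using h2(3) eq[of y2 k2] unfolding scale hk c_def[symmetric] by simp
        then show "(y2 + c/2)\<^sup>2 - k2\<^sup>2 = y - 7/16 + c" using r2 by simp
        have E: "4/3 * ((y1 + c/2)\<^sup>2 + (y2 + c/2)\<^sup>2 - (y1 + c/2) * (y2 + c/2))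
            - 2/3 * c * ((y1 + c/2) + (y2 + c/2)) + c\<^sup>2 / 3 = 4/3 * (y1\<^sup>2 + y2\<^sup>2 - y1 * y2)"
          by (simp add: power2_eq_square field_simps)
        show "4/3 * ((y1 + c/2)\<^sup>2 + (y2 + c/2)\<^sup>2 - (y1 + c/2) * (y2 + c/2))
            - 2/3 * corner_slope * ((y1 + c/2) + (y2 + c/2)) + corner_slope\<^sup>2 / 3
            \<le> y - 7/16 + c + 7/16 - corner_slope"
          using y unfolding c_def[symmetric] E by simp
      qed (use k in auto)
      then have "r^3 * (4/3 * (k1^3 + k2^3)) < r^3 * (7 * sqrt 7 / 48)"
        using r by simp
      moreover have "r^3 * (4/3 * (k1^3 + k2^3)) = 4/3 * h1^3 + 4/3 * h2^3"
        unfolding hk by (simp add: power_mult_distrib algebra_simps)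
      ultimately have "?G < point_price r"
        using h1(4) h2(4) by (simp add: point_price_def mult.commute)
      then show ?thesis by simp
    qed
  qed
  then show "?G \<le> point_price r"
    "?G = point_price r \<Longrightarrow> ?C \<or> side_gain r u1 z = point_price r \<or> side_gain r u2 z = point_price r"
    by blast+
qed

section \<open>Equilateral triangles\<close>

definition segment_gain :: "real \<Rightarrow> 'a::euclidean_space \<Rightarrow> 'a \<Rightarrow> 'a \<Rightarrow> real" where
  "segment_gain r P Q c =
     integral {0..1} (\<lambda>s. max 0 (dual_weight r s - (norm (linepath P Q s - c))\<^sup>2))"

text \<open>
  The centroid of the two segments of length \<open>r\<close> that start at \<open>P\<close> towards \<open>Q\<close> and \<open>R\<close>.
\<close>

definition corner_center :: "real \<Rightarrow> 'a::euclidean_space \<Rightarrow> 'a \<Rightarrow> 'a \<Rightarrow> 'a" where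
  "corner_center r P Q R = P + (r / 4) *\<^sub>R ((Q - P) + (R - P))"

text \<open>
  The positions on a side whose cell avoids the discounted ranges at both ends.
\<close>

definition side_points :: "real \<Rightarrow> 'a::euclidean_space \<Rightarrow> 'a \<Rightarrow> 'a set" where
  "side_points r P Q =
     (\<lambda>u. P + u *\<^sub>R (Q - P)) ` {r + sqrt 7 / 4 * r .. 1 - r - sqrt 7 / 4 * r}"

text \<open>
  Midpoints of the \<open>k\<close> cells of length \<open>sqrt 7 / 2 * r\<close> that start at distance \<open>r\<close> from \<open>P\<close>.
\<close>

definition cell_centers :: "real \<Rightarrow> nat \<Rightarrow> 'a::euclidean_space \<Rightarrow> 'a \<Rightarrow> 'a set" where
  "cell_centers r k P Q =
     (\<lambda>j. P + (r + sqrt 7 / 4 * r + real j * (sqrt 7 / 2 * r)) *\<^sub>R (Q - P)) ` {..<k}"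

definition equilateral :: "'a::euclidean_space \<Rightarrow> 'a \<Rightarrow> 'a \<Rightarrow> bool" where
  "equilateral P Q R \<longleftrightarrow> norm (Q - P) = 1 \<and> norm (R - Q) = 1 \<and> norm (P - R) = 1"

lemma equilateral_rotate: "equilateral P Q R \<Longrightarrow> equilateral Q R P"
  by (auto simp: equilateral_def)

lemma dot_self_diff: "(a - b) \<bullet> (a - b) = a \<bullet> a - 2 * (a \<bullet> b) + b \<bullet> b" for a b :: "'a::real_inner"
  by (simp add: inner_diff_left inner_diff_right inner_commute)

lemma equilateral_inner:
  assumes "equilateral P Q R"
  shows "(Q - P) \<bullet> (Q - P) = 1" "(R - P) \<bullet> (R - P) = 1" "(Q - P) \<bullet> (R - P) = 1/2"
proof -
  have n: "norm (Q - P) = 1" "norm (R - P) = 1" "norm ((R - P) - (Q - P)) = 1"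
    using assms by (auto simp: equilateral_def norm_minus_commute)
  show 1: "(Q - P) \<bullet> (Q - P) = 1" "(R - P) \<bullet> (R - P) = 1"
    using n by (simp_all add: dot_square_norm)
  have "((R - P) - (Q - P)) \<bullet> ((R - P) - (Q - P)) = 1"
    using n by (simp only: dot_square_norm power_one)
  then have "(R - P) \<bullet> (R - P) - 2 * ((Q - P) \<bullet> (R - P)) + (Q - P) \<bullet> (Q - P) = 1"
    unfolding dot_self_diff by (simp only: inner_commute)
  then show "(Q - P) \<bullet> (R - P) = 1/2" using 1 by linarith
qed

lemma linepath_diff: "linepath P Q s - c = s *\<^sub>R (Q - P) - (c - P)"
  by (simp add: linepath_def algebra_simps)

lemma norm_linepath_diff:
  assumes "norm (Q - P) = 1"
  shows "(norm (linepath P Q s - c))\<^sup>2 = s\<^sup>2 - 2 * ((c - P) \<bullet> (Q - P)) * s + (norm (c - P))\<^sup>2"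
proof -
  have "(norm (s *\<^sub>R (Q - P) - (c - P)))\<^sup>2
      = s\<^sup>2 * (norm (Q - P))\<^sup>2 - 2 * s * ((Q - P) \<bullet> (c - P)) + (norm (c - P))\<^sup>2"
    unfolding power2_norm_eq_inner dot_self_diff[of "s *\<^sub>R (Q - P)" "c - P"]
    by (simp add: power2_eq_square)
  then show ?thesis unfolding linepath_diff using assms by (simp add: inner_commute)
qed

lemma segment_gain_eq_side_gain:
  assumes "norm (Q - P) = 1"
  shows "segment_gain r P Q c = side_gain r ((c - P) \<bullet> (Q - P)) ((norm (c - P))\<^sup>2)"
  unfolding segment_gain_def side_gain_def norm_linepath_diff[OF assms] ..

lemma linepath_reflect: "linepath P Q (1 - s) = linepath Q P s"
  by (simp add: linepath_def)

lemma segment_gain_commute: "segment_gain r Q P c = segment_gain r P Q c"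
  using integral_reflect_unit[of "\<lambda>s. max 0 (dual_weight r s - (norm (linepath P Q s - c))\<^sup>2)"]
  unfolding segment_gain_def linepath_reflect dual_weight_reflect .

lemma side_points_commute: "side_points r Q P = side_points r P Q"
proof -
  have "side_points r Q P \<subseteq> side_points r P Q" for P Q :: 'a
  proof
    fix c assume "c \<in> side_points r Q P"
    then obtain u where u: "u \<in> {r + sqrt 7 / 4 * r .. 1 - r - sqrt 7 / 4 * r}" "c = Q + u *\<^sub>R (P - Q)"
      unfolding side_points_def by blast
    have "c = P + (1 - u) *\<^sub>R (Q - P)" unfolding u(2) by (simp add: algebra_simps)
    moreover have "1 - u \<in> {r + sqrt 7 / 4 * r .. 1 - r - sqrt 7 / 4 * r}" using u(1) by auto
    ultimately show "c \<in> side_points r P Q" unfolding side_points_def by blast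
  qed
  then show ?thesis by blast
qed

text \<open>
  The left side is the squared length of the projection of \<open>v\<close> to the span of \<open>e1\<close> and \<open>e2\<close>, computed with
  the inverse of their Gram matrix.
\<close>

lemma projection_bound:
  fixes e1 e2 v :: "'a::euclidean_space"
  assumes "e1 \<bullet> e1 = 1" "e2 \<bullet> e2 = 1" "e1 \<bullet> e2 = 1/2"
  defines "u1 \<equiv> v \<bullet> e1" and "u2 \<equiv> v \<bullet> e2"
  shows "4/3 * (u1\<^sup>2 + u2\<^sup>2 - u1 * u2) \<le> (norm v)\<^sup>2" (is ?le)
    and "(norm v)\<^sup>2 = 4/3 * (u1\<^sup>2 + u2\<^sup>2 - u1 * u2) \<Longrightarrow>
      v = (4/3 * (u1 - u2/2)) *\<^sub>R e1 + (4/3 * (u2 - u1/2)) *\<^sub>R e2"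
proof -
  define a where "a = 4/3 * (u1 - u2/2)"
  define b where "b = 4/3 * (u2 - u1/2)"
  define w where "w = v - (a *\<^sub>R e1 + b *\<^sub>R e2)"
  have "w \<bullet> w = v \<bullet> v - 2 * (a * u1 + b * u2) + (a * a + b * b + a * b)"
    unfolding w_def u1_def u2_def
    by (simp add: assms(1-3) algebra_simps inner_diff_left inner_diff_right inner_add_left inner_add_right
      inner_commute[of e1 v] inner_commute[of e2 v] inner_commute[of e2 e1])
  also have "\<dots> = (norm v)\<^sup>2 - 4/3 * (u1\<^sup>2 + u2\<^sup>2 - u1 * u2)"
    unfolding a_def b_def dot_square_norm by (simp add: power2_eq_square field_simps)
  finally have w: "w \<bullet> w = (norm v)\<^sup>2 - 4/3 * (u1\<^sup>2 + u2\<^sup>2 - u1 * u2)" .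
  show ?le using w inner_ge_zero[of w] by linarith
  assume "(norm v)\<^sup>2 = 4/3 * (u1\<^sup>2 + u2\<^sup>2 - u1 * u2)"
  then have "w \<bullet> w = 0" using w by linarith
  then have "w = 0" by simp
  then show "v = (4/3 * (u1 - u2/2)) *\<^sub>R e1 + (4/3 * (u2 - u1/2)) *\<^sub>R e2"
    unfolding w_def a_def b_def by simp
qed

lemma on_line_if_norm_eq:
  assumes "norm (Q - P) = 1" "(norm (c - P))\<^sup>2 = ((c - P) \<bullet> (Q - P))\<^sup>2"
  shows "c = P + ((c - P) \<bullet> (Q - P)) *\<^sub>R (Q - P)"
proof -
  have "(norm (linepath P Q ((c - P) \<bullet> (Q - P)) - c))\<^sup>2 = 0"
    unfolding norm_linepath_diff[OF assms(1)] assms(2) by (simp add: power2_eq_square)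
  then have "linepath P Q ((c - P) \<bullet> (Q - P)) = c" by simp
  then show ?thesis by (simp add: linepath_def algebra_simps)
qed

lemma segment_gain_eq_price:
  assumes r: "r > 0" and n: "norm (Q - P) = 1" and eq: "segment_gain r P Q c = point_price r"
  shows "c \<in> side_points r P Q"
proof -
  let ?u = "(c - P) \<bullet> (Q - P)"
  have "?u\<^sup>2 \<le> (norm (c - P))\<^sup>2"
    using Cauchy_Schwarz_ineq2[of "c - P" "Q - P"] n by (simp add: abs_le_square_iff[symmetric])
  then have "(norm (c - P))\<^sup>2 = ?u\<^sup>2" "?u \<in> {r + sqrt 7 / 4 * r .. 1 - r - sqrt 7 / 4 * r}"
    using side_gain_eq_price[OF r _ eq[unfolded segment_gain_eq_side_gain[OF n]]] by blast+
  then show ?thesis using on_line_if_norm_eq[OF n] unfolding side_points_def by blast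
qed

lemma vertex_gain:
  assumes r: "r > 0" and eqt: "equilateral P Q R"
  shows "segment_gain r P Q c + segment_gain r P R c \<le> point_price r"
    and "segment_gain r P Q c + segment_gain r P R c = point_price r \<Longrightarrow>
      c = corner_center r P Q R \<or> c \<in> side_points r P Q \<or> c \<in> side_points r P R"
proof -
  have n: "norm (Q - P) = 1" "norm (R - P) = 1"
    using eqt by (auto simp: equilateral_def norm_minus_commute)
  note i = equilateral_inner[OF eqt]
  let ?u1 = "(c - P) \<bullet> (Q - P)" and ?u2 = "(c - P) \<bullet> (R - P)" and ?z = "(norm (c - P))\<^sup>2"
  note z = projection_bound(1)[OF i, of "c - P"]
  note gain = segment_gain_eq_side_gain[OF n(1)] segment_gain_eq_side_gain[OF n(2)]
  show "segment_gain r P Q c + segment_gain r P R c \<le> point_price r"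
    unfolding gain by (rule corner_gain_le[OF r z])
  assume eq: "segment_gain r P Q c + segment_gain r P R c = point_price r"
  have "c = corner_center r P Q R"
    if u: "?u1 = 3/8 * r" "?u2 = 3/8 * r" "?z = 3/16 * r\<^sup>2"
  proof -
    have "?z = 4/3 * (?u1\<^sup>2 + ?u2\<^sup>2 - ?u1 * ?u2)" unfolding u by (simp add: power2_eq_square)
    then have "c - P = (4/3 * (?u1 - ?u2/2)) *\<^sub>R (Q - P) + (4/3 * (?u2 - ?u1/2)) *\<^sub>R (R - P)"
      by (rule projection_bound(2)[OF i])
    also have "\<dots> = (r / 4) *\<^sub>R ((Q - P) + (R - P))"
      unfolding u by (simp add: scaleR_add_right)
    finally show ?thesis unfolding corner_center_def by (simp only: diff_eq_eq add.commute)
  qed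
  then show "c = corner_center r P Q R \<or> c \<in> side_points r P Q \<or> c \<in> side_points r P R"
    using corner_gain_eq[OF r z] eq segment_gain_eq_price[OF r n(1)] segment_gain_eq_price[OF r n(2)]
    unfolding gain by blast
qed

text \<open>
  A point gains on a side only if it is closer than the largest offered weight allows, that is, closer
  than \<open>1 / sqrt 12\<close>, the inradius. No point is that close to the lines of all three sides. So its gain is
  a matter of the two sides at a single vertex.
\<close>

lemma some_side_inactive:
  assumes r: "r > 0" "r \<le> 2/5" and eqt: "equilateral P Q R"
  shows "segment_gain r P Q c = 0 \<or> segment_gain r Q R c = 0 \<or> segment_gain r R P c = 0"
proof (rule ccontr)
  assume contra: "\<not> ?thesis"
  have n: "norm (Q - P) = 1" "norm (R - P) = 1" "norm (R - Q) = 1"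
    using eqt by (auto simp: equilateral_def norm_minus_commute)
  note i = equilateral_inner[OF eqt]
  define u1 where "u1 = (c - P) \<bullet> (Q - P)"
  define u2 where "u2 = (c - P) \<bullet> (R - P)"
  define z where "z = (norm (c - P))\<^sup>2"
  have z: "4/3 * (u1\<^sup>2 + u2\<^sup>2 - u1 * u2) \<le> z"
    using projection_bound(1)[OF i, of "c - P"] by (simp add: u1_def u2_def z_def)
  have cQ: "c - Q = (c - P) - (Q - P)" and RQ: "R - Q = (R - P) - (Q - P)" by simp_all
  have u3: "(c - Q) \<bullet> (R - Q) = u2 - u1 + 1/2"
    unfolding cQ RQ u1_def u2_def inner_diff_left[of "c - P" "Q - P"]
      inner_diff_right[of _ "R - P" "Q - P"] using i by simp
  have z3: "(norm (c - Q))\<^sup>2 = z - 2 * u1 + 1"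
    unfolding cQ z_def u1_def power2_norm_eq_inner inner_diff_left[of "c - P" "Q - P"]
      inner_diff_right[of _ "c - P" "Q - P"] using i by (simp add: inner_commute)
  have "r\<^sup>2 \<le> (2/5)\<^sup>2" using r by (intro power_mono) auto
  then have small: "7/16 * r\<^sup>2 < 1/12" by (simp add: power2_eq_square)
  have "segment_gain r P Q c \<noteq> 0" "segment_gain r P R c \<noteq> 0" "segment_gain r Q R c \<noteq> 0"
    using contra segment_gain_commute[of r P R c] by auto
  then have "z - u1\<^sup>2 < 1/12" "z - u2\<^sup>2 < 1/12" "z - 2 * u1 + 1 - (u2 - u1 + 1/2)\<^sup>2 < 1/12"
    using side_gain_eq_0[of r z u1] side_gain_eq_0[of r z u2]
      side_gain_eq_0[of r "z - 2 * u1 + 1" "u2 - u1 + 1/2"] r small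
    unfolding segment_gain_eq_side_gain[OF n(1)] segment_gain_eq_side_gain[OF n(2)]
      segment_gain_eq_side_gain[OF n(3)] u3 z3 u1_def[symmetric] u2_def[symmetric] z_def[symmetric]
    by linarith+
  moreover have "4/3 * (u1\<^sup>2 + u2\<^sup>2 - u1 * u2) - u1\<^sup>2 = 1/3 * (2 * u2 - u1)\<^sup>2"
    "4/3 * (u1\<^sup>2 + u2\<^sup>2 - u1 * u2) - u2\<^sup>2 = 1/3 * (2 * u1 - u2)\<^sup>2"
    "4/3 * (u1\<^sup>2 + u2\<^sup>2 - u1 * u2) - 2 * u1 + 1 - (u2 - u1 + 1/2)\<^sup>2 = 1/3 * (3/2 - u1 - u2)\<^sup>2"
    by (simp_all add: power2_eq_square field_simps)
  ultimately have "1/3 * (2 * u2 - u1)\<^sup>2 < 1/12" "1/3 * (2 * u1 - u2)\<^sup>2 < 1/12"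
    "1/3 * (3/2 - u1 - u2)\<^sup>2 < 1/12"
    using z by linarith+
  then have sq: "(2 * u2 - u1)\<^sup>2 < (1/2)\<^sup>2" "(2 * u1 - u2)\<^sup>2 < (1/2)\<^sup>2"
    "(3/2 - u1 - u2)\<^sup>2 < (1/2)\<^sup>2"
    unfolding power_divide by simp_all
  have "2 * u2 - u1 < 1/2" "2 * u1 - u2 < 1/2" "3/2 - u1 - u2 < 1/2"
    using power2_less_imp_less[OF sq(1)] power2_less_imp_less[OF sq(2)]
      power2_less_imp_less[OF sq(3)] by simp_all
  then show False by linarith
qed

definition triangle_gain :: "real \<Rightarrow> 'a::euclidean_space \<Rightarrow> 'a \<Rightarrow> 'a \<Rightarrow> 'a \<Rightarrow> real" where
  "triangle_gain r P Q R c = segment_gain r P Q c + segment_gain r Q R c + segment_gain r R P c"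

definition corner_centers :: "real \<Rightarrow> 'a::euclidean_space \<Rightarrow> 'a \<Rightarrow> 'a \<Rightarrow> 'a set" where
  "corner_centers r P Q R = {corner_center r P Q R, corner_center r Q R P, corner_center r R P Q}"

lemma triangle_gain:
  assumes r: "r > 0" "r \<le> 2/5" and eqt: "equilateral P Q R"
  shows triangle_gain_le: "triangle_gain r P Q R c \<le> point_price r"
    and triangle_gain_eq: "triangle_gain r P Q R c = point_price r \<Longrightarrow>
      c \<in> corner_centers r P Q R \<union> side_points r P Q \<union> side_points r Q R \<union> side_points r R P"
proof -
  let ?C = "corner_centers r P Q R \<union> side_points r P Q \<union> side_points r Q R \<union> side_points r R P"
  have step: "triangle_gain r P Q R c \<le> point_price r \<and>
     (triangle_gain r P Q R c = point_price r \<longrightarrow>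
      c \<in> corner_centers r P Q R \<union> side_points r P Q \<union> side_points r Q R \<union> side_points r R P)"
    if "segment_gain r Q R c = 0" "equilateral P Q R" for P Q R :: 'a
    using vertex_gain[OF r(1) that(2), of c] that(1) segment_gain_commute[of r P R c]
      side_points_commute[of r P R]
    by (auto simp: triangle_gain_def corner_centers_def)
  have rot: "triangle_gain r Q R P c = triangle_gain r P Q R c"
    "corner_centers r Q R P = corner_centers r P Q R" for P Q R :: 'a
    by (auto simp: triangle_gain_def corner_centers_def)
  note e2 = equilateral_rotate[OF eqt]
  note e3 = equilateral_rotate[OF e2]
  have "triangle_gain r P Q R c \<le> point_price r \<and>
     (triangle_gain r P Q R c = point_price r \<longrightarrow> c \<in> ?C)"
    using some_side_inactive[OF r eqt, of c]
  proof (elim disjE)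
    assume "segment_gain r P Q c = 0"
    then show ?thesis
      using step[OF _ e3] unfolding rot(1)[of P Q R, symmetric] rot(2)[of P Q R, symmetric] by blast
  next
    assume "segment_gain r Q R c = 0"
    then show ?thesis using step[OF _ eqt] by blast
  next
    assume "segment_gain r R P c = 0"
    then show ?thesis
      using step[OF _ e2] unfolding rot(1)[of Q R P] rot(2)[of Q R P] by blast
  qed
  then show "triangle_gain r P Q R c \<le> point_price r"
    "triangle_gain r P Q R c = point_price r \<Longrightarrow> c \<in> ?C" by blast+
qed

text \<open>
  The packing argument behind uniqueness. Splitting off the maximum leaves separated points in an
  interval that is shorter by \<open>d\<close>, to which induction applies.
\<close>

lemma separated_points_in_interval:
  fixes a d :: real
  assumes d: "d > 0" and fin: "finite U" and sub: "U \<subseteq> {a..a + (real k - 1) * d}"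
    and sep: "\<And>x y. x \<in> U \<Longrightarrow> y \<in> U \<Longrightarrow> x \<noteq> y \<Longrightarrow> d \<le> \<bar>x - y\<bar>"
  shows "card U \<le> k \<and> (card U = k \<longrightarrow> U = (\<lambda>j. a + real j * d) ` {..<k})"
  using fin sub sep
proof (induction k arbitrary: U)
  case 0
  then have "U = {}" using d by auto
  then show ?case by simp
next
  case (Suc k)
  show ?case
  proof (cases "U = {}")
    case False
    define m where "m = Max U"
    define V where "V = U - {m}"
    have m: "m \<in> U" "\<And>x. x \<in> U \<Longrightarrow> x \<le> m" using Suc.prems(1) False by (auto simp: m_def)
    have mle: "m \<le> a + real k * d" and mge: "a \<le> m" using m(1) Suc.prems(2) by auto
    have V: "x \<le> m - d" if "x \<in> V" for x
      using that m Suc.prems(3)[of x m] by (force simp: V_def)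
    have "V \<subseteq> {a..a + (real k - 1) * d}"
      using V mle Suc.prems(2) by (fastforce simp: V_def algebra_simps)
    then have IH: "card V \<le> k \<and> (card V = k \<longrightarrow> V = (\<lambda>j. a + real j * d) ` {..<k})"
      using Suc.prems by (intro Suc.IH) (auto simp: V_def)
    have card: "card U = Suc (card V)"
      unfolding V_def using Suc.prems(1) m(1) by (rule card.remove)
    have UV: "U = insert m V" using m(1) by (auto simp: V_def)
    show ?thesis
    proof (intro conjI impI)
      show "card U \<le> Suc k" using card IH by simp
      assume "card U = Suc k"
      then have Veq: "V = (\<lambda>j. a + real j * d) ` {..<k}" using card IH by simp
      have "m \<ge> a + real k * d"
      proof (cases k)
        case 0 then show ?thesis using mge by simp
      next
        case (Suc i)
        then have "a + real i * d \<in> V" using Veq by auto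
        then show ?thesis using V Suc by (force simp: algebra_simps)
      qed
      then have "m = a + real k * d" using mle by simp
      then show "U = (\<lambda>j. a + real j * d) ` {..<Suc k}"
        using UV Veq by (simp add: lessThan_Suc)
    qed
  qed simp
qed

section \<open>The lower bound and its equality case\<close>

definition sq_dist :: "'a::euclidean_space set \<Rightarrow> 'a \<Rightarrow> real" where
  "sq_dist \<alpha> x = (MIN c\<in>\<alpha>. (norm (x - c))\<^sup>2)"

lemma sq_dist_le: "finite \<alpha> \<Longrightarrow> c \<in> \<alpha> \<Longrightarrow> sq_dist \<alpha> x \<le> (norm (x - c))\<^sup>2"
  by (simp add: sq_dist_def)

lemma sq_dist_attained:
  assumes "finite \<alpha>" "\<alpha> \<noteq> {}"
  obtains c where "c \<in> \<alpha>" "sq_dist \<alpha> x = (norm (x - c))\<^sup>2"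
proof -
  have "sq_dist \<alpha> x \<in> (\<lambda>c. (norm (x - c))\<^sup>2) ` \<alpha>"
    unfolding sq_dist_def using assms by (intro Min_in) auto
  then show thesis using that by auto
qed

lemma continuous_on_sq_dist:
  assumes "finite \<alpha>" "\<alpha> \<noteq> {}"
  shows "continuous_on UNIV (sq_dist \<alpha>)"
  using assms
proof (induction rule: finite_ne_induct)
  case (singleton c)
  show ?case unfolding sq_dist_def by (auto intro!: continuous_intros)
next
  case (insert c F)
  have "sq_dist (insert c F) = (\<lambda>x. min ((norm (x - c))\<^sup>2) (sq_dist F x))"
    using insert.hyps by (simp add: sq_dist_def fun_eq_iff)
  then show ?case using insert.IH by (auto intro!: continuous_intros)
qed

lemma continuous_on_sq_dist' [continuous_intros]:
  assumes "finite \<alpha>" "\<alpha> \<noteq> {}" "continuous_on S f"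
  shows "continuous_on S (\<lambda>s. sq_dist \<alpha> (f s))"
  using continuous_on_compose2[OF continuous_on_sq_dist[OF assms(1,2)] assms(3)] by simp

lemma continuous_on_linepath_sq [continuous_intros]:
  "continuous_on S (\<lambda>s. (norm (linepath P Q s - c))\<^sup>2)"
  unfolding linepath_def by (intro continuous_intros)

text \<open>
  The amount by which the dual bound is not sharp at a boundary point: it is positive if several points would
  profit from serving it, or if every point would lose by doing so.
\<close>

definition cover_excess :: "real \<Rightarrow> 'a::euclidean_space \<Rightarrow> 'a \<Rightarrow> 'a set \<Rightarrow> real \<Rightarrow> real" where
  "cover_excess r P Q \<alpha> s = (\<Sum>c\<in>\<alpha>. max 0 (dual_weight r s - (norm (linepath P Q s - c))\<^sup>2))
     - (dual_weight r s - sq_dist \<alpha> (linepath P Q s))"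

definition side_distortion :: "'a::euclidean_space \<Rightarrow> 'a \<Rightarrow> 'a set \<Rightarrow> real" where
  "side_distortion P Q \<alpha> = integral {0..1} (\<lambda>s. sq_dist \<alpha> (linepath P Q s))"

lemma cover_excess_nonneg:
  assumes "finite \<alpha>" "\<alpha> \<noteq> {}"
  shows "cover_excess r P Q \<alpha> s \<ge> 0"
proof -
  let ?g = "\<lambda>c. max 0 (dual_weight r s - (norm (linepath P Q s - c))\<^sup>2)"
  obtain c where c: "c \<in> \<alpha>" "sq_dist \<alpha> (linepath P Q s) = (norm (linepath P Q s - c))\<^sup>2"
    using sq_dist_attained[OF assms] by blast
  have "?g c \<le> sum ?g \<alpha>" using assms c by (intro member_le_sum) auto
  then show ?thesis using c unfolding cover_excess_def by simp
qed

lemma cover_excess_pos: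
  assumes fin: "finite \<alpha>" and c: "c1 \<in> \<alpha>" "c2 \<in> \<alpha>" "c1 \<noteq> c2"
    and pos: "(norm (linepath P Q s - c1))\<^sup>2 < dual_weight r s"
      "(norm (linepath P Q s - c2))\<^sup>2 < dual_weight r s"
  shows "cover_excess r P Q \<alpha> s > 0"
proof -
  let ?g = "\<lambda>c. max 0 (dual_weight r s - (norm (linepath P Q s - c))\<^sup>2)"
  obtain c0 where c0: "c0 \<in> \<alpha>" "sq_dist \<alpha> (linepath P Q s) = (norm (linepath P Q s - c0))\<^sup>2"
    using sq_dist_attained[of \<alpha>] fin c by blast
  obtain c' where c': "c' \<in> \<alpha>" "c' \<noteq> c0" "?g c' > 0"
    using c pos by (metis diff_gt_0_iff_gt less_max_iff_disj)
  have "?g c0 + ?g c' = sum ?g {c0, c'}" using c' by simp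
  also have "\<dots> \<le> sum ?g \<alpha>" using fin c0 c' by (intro sum_mono2) auto
  finally show ?thesis using c0 c' unfolding cover_excess_def by linarith
qed

lemma continuous_on_cover_excess:
  assumes "finite \<alpha>" "\<alpha> \<noteq> {}"
  shows "continuous_on S (cover_excess r P Q \<alpha>)"
  unfolding cover_excess_def
  by (intro continuous_intros assms continuous_on_linepath)

lemma integral_dual_weight:
  assumes "0 < r" "r \<le> 1"
  shows "integral {0..1} (dual_weight r) = 7/16 * r\<^sup>2 - corner_slope * r^3"
proof -
  let ?t = "\<lambda>s::real. max 0 (r - s)"
  have int: "?t integrable_on {a..b}" "(\<lambda>s. max 0 (r - (1 - s))) integrable_on {a..b}" for a b
    by (intro integrable_continuous_real continuous_intros)+
  have "integral {0..1} ?t = integral {0..r} ?t + integral {r..1} ?t"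
    using Henstock_Kurzweil_Integration.integral_combine[OF _ _ int(1), of 0 r 1] assms by simp
  also have "integral {0..r} ?t = integral {0..r} (\<lambda>s. r - s)"
    by (rule Henstock_Kurzweil_Integration.integral_cong) simp
  also have "\<dots> = r\<^sup>2 / 2"
  proof -
    have "((\<lambda>s. r - s) has_integral (r * r - r\<^sup>2 / 2) - (r * 0 - 0\<^sup>2 / 2)) {0..r}"
      using assms by (intro fundamental_theorem_of_calculus)
       (auto intro!: derivative_eq_intros simp flip: has_real_derivative_iff_has_vector_derivative)
    then show ?thesis by (simp add: integral_unique power2_eq_square)
  qed
  also have "integral {r..1} ?t = integral {r..1} (\<lambda>s::real. 0)"
    by (rule Henstock_Kurzweil_Integration.integral_cong) simp
  finally have t: "integral {0..1} ?t = r\<^sup>2 / 2" by simp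
  have t': "integral {0..1} (\<lambda>s. max 0 (r - (1 - s))) = r\<^sup>2 / 2"
    using integral_reflect_unit[of ?t] t by simp
  have "integral {0..1} (dual_weight r) = integral {0..1} (\<lambda>s::real. 7/16 * r\<^sup>2)
      - integral {0..1} (\<lambda>s. corner_slope * r * (?t s + max 0 (r - (1 - s))))"
    unfolding dual_weight_def
    by (intro Henstock_Kurzweil_Integration.integral_diff integrable_continuous_real continuous_intros)
  also have "integral {0..1} (\<lambda>s. corner_slope * r * (?t s + max 0 (r - (1 - s))))
      = corner_slope * r * (r\<^sup>2 / 2 + r\<^sup>2 / 2)"
    unfolding Henstock_Kurzweil_Integration.integral_mult_right
      Henstock_Kurzweil_Integration.integral_add[OF int] t t' ..
  finally show ?thesis by (simp add: power2_eq_square power3_eq_cube)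
qed

text \<open>
  Weak duality as an identity: distortion equals total weight minus the gains of the points plus the
  excess, which is nonnegative.
\<close>

lemma side_distortion_eq:
  assumes r: "0 < r" "r \<le> 1" and \<alpha>: "finite \<alpha>" "\<alpha> \<noteq> {}"
  shows "side_distortion P Q \<alpha> = 7/16 * r\<^sup>2 - corner_slope * r^3
    - (\<Sum>c\<in>\<alpha>. segment_gain r P Q c) + integral {0..1} (cover_excess r P Q \<alpha>)"
proof -
  let ?g = "\<lambda>c s. max 0 (dual_weight r s - (norm (linepath P Q s - c))\<^sup>2)"
  have ig: "?g c integrable_on {0..1}" for c
    by (intro integrable_continuous_real continuous_intros)
  have iw: "dual_weight r integrable_on {0..1}"
    by (intro integrable_continuous_real continuous_on_dual_weight continuous_on_id)
  have im: "(\<lambda>s. sq_dist \<alpha> (linepath P Q s)) integrable_on {0..1}"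
    by (intro integrable_continuous_real continuous_intros \<alpha>)
  have "integral {0..1} (cover_excess r P Q \<alpha>)
     = (\<Sum>c\<in>\<alpha>. integral {0..1} (?g c)) - (integral {0..1} (dual_weight r) - side_distortion P Q \<alpha>)"
    unfolding cover_excess_def side_distortion_def
    using ig iw im \<alpha>(1)
    by (simp add: Henstock_Kurzweil_Integration.integral_diff Henstock_Kurzweil_Integration.integral_sum
        integrable_sum integrable_diff)
  then show ?thesis using integral_dual_weight[OF r] unfolding segment_gain_def by linarith
qed

lemma norm_linepath_side_point:
  assumes "norm (Q - P) = 1"
  shows "(norm (linepath P Q s - (P + v *\<^sub>R (Q - P))))\<^sup>2 = (s - v)\<^sup>2"
proof -
  have "linepath P Q s - (P + v *\<^sub>R (Q - P)) = (s - v) *\<^sub>R (Q - P)"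
    by (simp add: linepath_def algebra_simps)
  then show ?thesis using assms by simp
qed

text \<open>
  Without excess, the cells of two side points cannot overlap: otherwise both would profit at the
  midpoint between them.
\<close>

lemma side_points_separated:
  assumes r: "r > 0" and n: "norm (Q - P) = 1" and \<alpha>: "finite \<alpha>" "\<alpha> \<noteq> {}"
    and zero: "integral {0..1} (cover_excess r P Q \<alpha>) = 0"
    and u: "u \<in> {r + sqrt 7 / 4 * r .. 1 - r - sqrt 7 / 4 * r}" "P + u *\<^sub>R (Q - P) \<in> \<alpha>"
    and u': "u' \<in> {r + sqrt 7 / 4 * r .. 1 - r - sqrt 7 / 4 * r}" "P + u' *\<^sub>R (Q - P) \<in> \<alpha>"
    and ne: "u \<noteq> u'"
  shows "sqrt 7 / 2 * r \<le> \<bar>u - u'\<bar>"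
proof (rule ccontr)
  assume contra: "\<not> sqrt 7 / 2 * r \<le> \<bar>u - u'\<bar>"
  define s where "s = u / 2 + u' / 2"
  have h: "sqrt 7 / 4 * r > 0" using r by simp
  have s: "r \<le> s" "r \<le> 1 - s" using u(1) u'(1) h unfolding s_def atLeastAtMost_iff by linarith+
  then have w: "dual_weight r s = (sqrt 7 / 4 * r)\<^sup>2" unfolding half_cell_square by (simp add: dual_weight_def)
  have close: "(norm (linepath P Q s - (P + v *\<^sub>R (Q - P))))\<^sup>2 < dual_weight r s"
    if "\<bar>s - v\<bar> < sqrt 7 / 4 * r" for v
  proof -
    have "(norm (linepath P Q s - (P + v *\<^sub>R (Q - P))))\<^sup>2 = \<bar>s - v\<bar>\<^sup>2"
      using norm_linepath_side_point[OF n] by simp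
    also have "\<dots> < (sqrt 7 / 4 * r)\<^sup>2" using that by (intro power_strict_mono) auto
    finally show ?thesis unfolding w .
  qed
  have "\<bar>s - u\<bar> = \<bar>u - u'\<bar> / 2" "\<bar>s - u'\<bar> = \<bar>u - u'\<bar> / 2" by (auto simp: s_def abs_if field_simps)
  then have "\<bar>s - u\<bar> < sqrt 7 / 4 * r" "\<bar>s - u'\<bar> < sqrt 7 / 4 * r" using contra by auto
  moreover have "P + u *\<^sub>R (Q - P) \<noteq> P + u' *\<^sub>R (Q - P)" using ne n by auto
  ultimately have "cover_excess r P Q \<alpha> s > 0"
    using cover_excess_pos[OF \<alpha>(1) u(2) u'(2)] close by blast
  moreover have "\<forall>t\<in>{0..1}. cover_excess r P Q \<alpha> t = 0"
    using integral_cbox_eq_0_iff[of 0 "1::real" "cover_excess r P Q \<alpha>"] zero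
      continuous_on_cover_excess[OF \<alpha>] cover_excess_nonneg[OF \<alpha>] by simp
  moreover have "s \<in> {0..1}" using s r by auto
  ultimately show False by auto
qed

lemma side_points_card:
  assumes r: "r > 0" and n: "norm (Q - P) = 1" and \<alpha>: "finite \<alpha>" "\<alpha> \<noteq> {}"
    and zero: "integral {0..1} (cover_excess r P Q \<alpha>) = 0"
    and k: "1 - 2 * r = real k * (sqrt 7 / 2 * r)"
  shows "card (\<alpha> \<inter> side_points r P Q) \<le> k"
    and "card (\<alpha> \<inter> side_points r P Q) = k \<Longrightarrow> \<alpha> \<inter> side_points r P Q = cell_centers r k P Q"
proof -
  define x where "x = (\<lambda>u. P + u *\<^sub>R (Q - P))"
  define U where "U = {u \<in> {r + sqrt 7 / 4 * r .. 1 - r - sqrt 7 / 4 * r}. x u \<in> \<alpha>}"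
  have inj: "inj_on x U" using n by (auto simp: x_def inj_on_def)
  have img: "\<alpha> \<inter> side_points r P Q = x ` U" unfolding side_points_def U_def x_def by auto
  have fin: "finite U" using finite_imageD[OF _ inj] \<alpha>(1) img by (metis finite_Int)
  have card: "card (\<alpha> \<inter> side_points r P Q) = card U" unfolding img by (rule card_image[OF inj])
  have sub: "U \<subseteq> {r + sqrt 7 / 4 * r .. (r + sqrt 7 / 4 * r) + (real k - 1) * (sqrt 7 / 2 * r)}"
  proof -
    have kd: "(real k - 1) * (sqrt 7 / 2 * r) = 1 - 2 * r - sqrt 7 / 2 * r"
      unfolding k by (simp only: left_diff_distrib mult_1)
    have top: "(r + sqrt 7 / 4 * r) + (real k - 1) * (sqrt 7 / 2 * r) = 1 - r - sqrt 7 / 4 * r"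
      unfolding kd by (simp add: field_simps)
    show ?thesis unfolding top by (auto simp: U_def)
  qed
  have pack: "card U \<le> k \<and> (card U = k \<longrightarrow>
      U = (\<lambda>j. (r + sqrt 7 / 4 * r) + real j * (sqrt 7 / 2 * r)) ` {..<k})"
  proof (rule separated_points_in_interval[OF _ fin sub])
    fix u u' assume "u \<in> U" "u' \<in> U" "u \<noteq> u'"
    then show "sqrt 7 / 2 * r \<le> \<bar>u - u'\<bar>"
      using side_points_separated[OF r n \<alpha> zero] unfolding U_def x_def by blast
  qed (use r in simp)
  show "card (\<alpha> \<inter> side_points r P Q) \<le> k" using card pack by simp
  assume "card (\<alpha> \<inter> side_points r P Q) = k"
  then have "U = (\<lambda>j. (r + sqrt 7 / 4 * r) + real j * (sqrt 7 / 2 * r)) ` {..<k}" using card pack by simp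
  then show "\<alpha> \<inter> side_points r P Q = cell_centers r k P Q"
    unfolding img cell_centers_def x_def by (simp add: image_image)
qed

definition triangle_distortion :: "'a::euclidean_space \<Rightarrow> 'a \<Rightarrow> 'a \<Rightarrow> 'a set \<Rightarrow> real" where
  "triangle_distortion P Q R \<alpha> = side_distortion P Q \<alpha> + side_distortion Q R \<alpha> + side_distortion R P \<alpha>"

definition triangle_centers :: "real \<Rightarrow> nat \<Rightarrow> 'a::euclidean_space \<Rightarrow> 'a \<Rightarrow> 'a \<Rightarrow> 'a set" where
  "triangle_centers r k P Q R = corner_centers r P Q R \<union>
     (cell_centers r k P Q \<union> cell_centers r k Q R \<union> cell_centers r k R P)"

text \<open>
  The total weight minus \<open>3 * k + 3\<close> prices is the value to be proved optimal.
\<close>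

lemma dual_value:
  assumes k: "1 - 2 * r = real k * (sqrt 7 / 2 * r)"
  shows "3 * (7/16 * r\<^sup>2 - corner_slope * r^3) - real (3 * k + 3) * point_price r = 7/16 * r\<^sup>2"
proof -
  have "real (3 * k) * point_price r = 7/8 * r\<^sup>2 * (1 - 2 * r)"
    unfolding k point_price_def by (simp add: power2_eq_square power3_eq_cube)
  then show ?thesis
    by (simp add: point_price_def corner_slope_def power2_eq_square power3_eq_cube field_simps)
qed

text \<open>
  Each point gains at most the price, so the distortion is at least the total weight minus one price
  per point. In case of equality all \<open>3 * k + 3\<close> points are used, each gains the full price, and there is no
  excess. So they are corner points or separated side points; at most three are of the first kind and at
  most \<open>k\<close> lie on each side, hence all these bounds are attained, and packing determines the points.
\<close>

lemma triangle_distortion_lower_bound: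
  assumes r: "0 < r" "r \<le> 2/5" and k: "1 - 2 * r = real k * (sqrt 7 / 2 * r)"
    and eqt: "equilateral P Q R" and \<alpha>: "finite \<alpha>" "\<alpha> \<noteq> {}" and card: "card \<alpha> \<le> 3 * k + 3"
  shows "7/16 * r\<^sup>2 \<le> triangle_distortion P Q R \<alpha>"
    and "triangle_distortion P Q R \<alpha> = 7/16 * r\<^sup>2 \<Longrightarrow> \<alpha> = triangle_centers r k P Q R"
proof -
  have r1: "r \<le> 1" using r by simp
  have n: "norm (Q - P) = 1" "norm (R - Q) = 1" "norm (P - R) = 1" using eqt by (auto simp: equilateral_def)
  let ?E = "\<lambda>P Q. integral {0..1} (cover_excess r P Q \<alpha>)"
  have E: "?E P Q \<ge> 0" for P Q :: 'a
    by (intro integral_nonneg integrable_continuous_real continuous_on_cover_excess cover_excess_nonneg \<alpha>)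
  have eq: "triangle_distortion P Q R \<alpha> = 3 * (7/16 * r\<^sup>2 - corner_slope * r^3)
     - (\<Sum>c\<in>\<alpha>. triangle_gain r P Q R c) + (?E P Q + ?E Q R + ?E R P)"
    unfolding triangle_distortion_def triangle_gain_def sum.distrib
      side_distortion_eq[OF r(1) r1 \<alpha>] by simp
  have gain: "(\<Sum>c\<in>\<alpha>. triangle_gain r P Q R c) \<le> real (card \<alpha>) * point_price r"
    using sum_bounded_above[of \<alpha> "triangle_gain r P Q R" "point_price r"] triangle_gain_le[OF r eqt] by simp
  have price: "point_price r > 0" using r by (simp add: point_price_pos)
  have cardp: "real (card \<alpha>) * point_price r \<le> real (3 * k + 3) * point_price r"
    using card price by (intro mult_right_mono) (simp_all only: of_nat_le_iff less_imp_le)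
  show "7/16 * r\<^sup>2 \<le> triangle_distortion P Q R \<alpha>"
    using eq gain cardp E[of P Q] E[of Q R] E[of R P] dual_value[OF k] by linarith
  assume opt: "triangle_distortion P Q R \<alpha> = 7/16 * r\<^sup>2"
  have "real (card \<alpha>) * point_price r = real (3 * k + 3) * point_price r"
    and sum: "(\<Sum>c\<in>\<alpha>. triangle_gain r P Q R c) = real (card \<alpha>) * point_price r"
    and zero: "?E P Q = 0" "?E Q R = 0" "?E R P = 0"
    using opt eq gain cardp E[of P Q] E[of Q R] E[of R P] dual_value[OF k] by linarith+
  then have cardeq: "card \<alpha> = 3 * k + 3" using price by (simp only: mult_cancel_right of_nat_eq_iff) auto
  have "(\<Sum>c\<in>\<alpha>. point_price r - triangle_gain r P Q R c) = 0"
    using sum by (simp add: sum_subtractf)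
  then have "\<forall>c\<in>\<alpha>. point_price r - triangle_gain r P Q R c = 0"
    using triangle_gain_le[OF r eqt] \<alpha>(1) by (subst (asm) sum_nonneg_eq_0_iff) auto
  then have "c \<in> corner_centers r P Q R \<union> side_points r P Q \<union> side_points r Q R \<union> side_points r R P"
    if "c \<in> \<alpha>" for c
    using triangle_gain_eq[OF r eqt, of c] that by simp
  then have split: "\<alpha> = (\<alpha> \<inter> corner_centers r P Q R) \<union> ((\<alpha> \<inter> side_points r P Q)
      \<union> (\<alpha> \<inter> side_points r Q R) \<union> (\<alpha> \<inter> side_points r R P))" (is "_ = ?A \<union> (?B \<union> ?C \<union> ?D)") by blast
  note B = side_points_card[OF r(1) n(1) \<alpha> zero(1) k]
  note C = side_points_card[OF r(1) n(2) \<alpha> zero(2) k]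
  note D = side_points_card[OF r(1) n(3) \<alpha> zero(3) k]
  have fin: "finite (corner_centers r P Q R)" and c3: "card (corner_centers r P Q R) \<le> 3"
    unfolding corner_centers_def by (auto simp: card_insert_if)
  have A: "card ?A \<le> card (corner_centers r P Q R)" using fin by (intro card_mono) auto
  have "card \<alpha> \<le> card ?A + (card ?B + card ?C + card ?D)"
    by (subst split) (meson card_Un_le order_trans add_mono le_refl)
  then have eqs: "card ?B = k" "card ?C = k" "card ?D = k" "card ?A = card (corner_centers r P Q R)"
    using cardeq A c3 B(1) C(1) D(1) by linarith+
  have "?A = corner_centers r P Q R" using fin eqs(4) by (intro card_subset_eq) auto
  then show "\<alpha> = triangle_centers r k P Q R"
    using split B(2)[OF eqs(1)] C(2)[OF eqs(2)] D(2)[OF eqs(3)] unfolding triangle_centers_def by simp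
qed

section \<open>The distortion of the candidate\<close>

lemma integral_shifted_square:
  fixes a b u w :: real
  assumes "a \<le> b"
  shows "integral {a..b} (\<lambda>s. (s - u)\<^sup>2 + w) = ((b - u)^3 - (a - u)^3) / 3 + w * (b - a)"
proof -
  have "((\<lambda>s. (s - u)\<^sup>2 + w) has_integral
      ((b - u)^3 / 3 + w * b) - ((a - u)^3 / 3 + w * a)) {a..b}"
    using assms
    by (intro fundamental_theorem_of_calculus)
       (auto intro!: derivative_eq_intros simp flip: has_real_derivative_iff_has_vector_derivative)
  then show ?thesis by (simp add: integral_unique field_simps)
qed

lemma norm_linepath_corner_center:
  assumes "equilateral P Q R"
  shows "(norm (linepath P Q s - corner_center r P Q R))\<^sup>2 = (s - 3/8 * r)\<^sup>2 + 3/64 * r\<^sup>2"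
proof -
  note i = equilateral_inner[OF assms]
  have n: "norm (Q - P) = 1" using assms by (simp add: equilateral_def)
  define a where "a = Q - P"
  define b where "b = R - P"
  note i' = i[folded a_def b_def]
  have c: "corner_center r P Q R - P = (r / 4) *\<^sub>R (a + b)"
    by (simp add: corner_center_def a_def b_def)
  have u: "(corner_center r P Q R - P) \<bullet> (Q - P) = 3/8 * r"
    unfolding c a_def[symmetric] by (simp add: i' inner_add_left inner_commute[of b a])
  have z: "(norm (corner_center r P Q R - P))\<^sup>2 = 3/16 * r\<^sup>2"
    unfolding c power2_norm_eq_inner
    by (simp add: i' inner_add_left inner_add_right inner_commute[of b a] power2_eq_square)
  show ?thesis
    unfolding norm_linepath_diff[OF n] u z by (simp add: power2_eq_square field_simps)
qed

lemma corner_center_swap: "corner_center r P R Q = corner_center r P Q R"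
  unfolding corner_center_def by (simp only: add.commute)

lemma cell_centers_commute:
  assumes k: "1 - 2 * r = real k * (sqrt 7 / 2 * r)"
  shows "cell_centers r k Q P = cell_centers r k P Q"
proof -
  have "cell_centers r k Q P \<subseteq> cell_centers r k P Q" for P Q :: 'a
  proof
    fix c assume "c \<in> cell_centers r k Q P"
    then obtain j where j: "j < k" "c = Q + (r + sqrt 7 / 4 * r + real j * (sqrt 7 / 2 * r)) *\<^sub>R (P - Q)"
      unfolding cell_centers_def by auto
    define i where "i = k - 1 - j"
    have ij: "real i + real j + 1 = real k" "i < k" using j by (auto simp: i_def)
    have "r + sqrt 7 / 4 * r + real i * (sqrt 7 / 2 * r)
        = 1 - (r + sqrt 7 / 4 * r + real j * (sqrt 7 / 2 * r))"
      using k unfolding ij(1)[symmetric] by (simp add: field_simps)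
    then have "c = P + (r + sqrt 7 / 4 * r + real i * (sqrt 7 / 2 * r)) *\<^sub>R (Q - P)"
      unfolding j(2) by (simp only: scaleR_diff_left scaleR_diff_right scaleR_one) simp
    then show "c \<in> cell_centers r k P Q" using ij(2) unfolding cell_centers_def by blast
  qed
  then show ?thesis by blast
qed

text \<open>
  It suffices to assign the points of a side to centres in the obvious way: the two ends of length \<open>r\<close>
  to the corner centres, the rest in cells.
\<close>

lemma side_distortion_le:
  assumes r: "0 < r" and k: "1 - 2 * r = real k * (sqrt 7 / 2 * r)"
    and eqt: "equilateral P Q R" and \<alpha>: "finite \<alpha>" "\<alpha> \<noteq> {}"
    and corners: "corner_center r P Q R \<in> \<alpha>" "corner_center r Q R P \<in> \<alpha>"
    and cells: "cell_centers r k P Q \<subseteq> \<alpha>"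
  shows "side_distortion P Q \<alpha> \<le> 7/24 * r^3 + real k * ((sqrt 7 / 2 * r)^3 / 12)"
proof -
  define d where "d = sqrt 7 / 2 * r"
  have d: "d > 0" using r by (simp add: d_def)
  have kd: "r + real k * d = 1 - r" using k by (simp add: d_def)
  have kd0: "real k * d \<ge> 0" using d by simp
  have n: "norm (Q - P) = 1" using eqt by (simp add: equilateral_def)
  define M where "M = (\<lambda>s. sq_dist \<alpha> (linepath P Q s))"
  have int: "M integrable_on {a..b}" for a b
    unfolding M_def by (intro integrable_continuous_real continuous_intros \<alpha>)
  have piece: "integral {a..b} M \<le> ((b - u)^3 - (a - u)^3) / 3 + w * (b - a)"
    if "a \<le> b" "\<And>s. M s \<le> (s - u)\<^sup>2 + w" for a b u w
  proof -
    have "integral {a..b} M \<le> integral {a..b} (\<lambda>s. (s - u)\<^sup>2 + w)"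
      using that(2) by (intro integral_le int integrable_continuous_real continuous_intros)
    then show ?thesis unfolding integral_shifted_square[OF that(1)] .
  qed
  have first: "integral {0..r} M \<le> 7/48 * r^3"
  proof -
    have "M s \<le> (s - 3/8 * r)\<^sup>2 + 3/64 * r\<^sup>2" for s
      using sq_dist_le[OF \<alpha>(1) corners(1), of "linepath P Q s"]
      unfolding norm_linepath_corner_center[OF eqt] M_def .
    from piece[OF less_imp_le[OF r] this] show ?thesis
      by (simp add: power2_eq_square power3_eq_cube field_simps)
  qed
  have last: "integral {1 - r..1} M \<le> 7/48 * r^3"
  proof -
    have eqt': "equilateral Q P R" using eqt by (auto simp: equilateral_def norm_minus_commute)
    have "M s \<le> (s - (1 - 3/8 * r))\<^sup>2 + 3/64 * r\<^sup>2" for s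
    proof -
      have "M s \<le> (1 - s - 3/8 * r)\<^sup>2 + 3/64 * r\<^sup>2"
        using sq_dist_le[OF \<alpha>(1) corners(2), of "linepath P Q s"]
        unfolding corner_center_swap[of r Q P R, symmetric] linepath_reflect[of Q P s, symmetric]
          norm_linepath_corner_center[OF eqt'] M_def .
      then show ?thesis by (simp add: power2_eq_square algebra_simps)
    qed
    from piece[OF _ this, of "1 - r" 1] r show ?thesis
      by (simp add: power2_eq_square power3_eq_cube field_simps)
  qed
  have middle: "integral {r..r + real j * d} M \<le> real j * (d^3 / 12)" if "j \<le> k" for j
    using that
  proof (induction j)
    case (Suc j)
    have "M s \<le> (s - (r + d / 2 + real j * d))\<^sup>2 + 0" for s
    proof -
      have mem: "P + (r + sqrt 7 / 4 * r + real j * d) *\<^sub>R (Q - P) \<in> cell_centers r k P Q"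
        unfolding cell_centers_def d_def by (rule image_eqI[OF refl]) (use Suc.prems in simp)
      have half: "sqrt 7 / 4 * r = d / 2" by (simp add: d_def)
      have "P + (r + d / 2 + real j * d) *\<^sub>R (Q - P) \<in> \<alpha>"
        using mem cells unfolding half by blast
      from sq_dist_le[OF \<alpha>(1) this, of "linepath P Q s"] show ?thesis
        unfolding norm_linepath_side_point[OF n] M_def by simp
    qed
    from piece[OF _ this, of "r + real j * d" "r + real (Suc j) * d"] d
    have "integral {r + real j * d..r + real (Suc j) * d} M \<le> d^3 / 12"
      by (simp add: power3_eq_cube field_simps)
    moreover have "integral {r..r + real j * d} M + integral {r + real j * d..r + real (Suc j) * d} M
        = integral {r..r + real (Suc j) * d} M"
      using d by (intro Henstock_Kurzweil_Integration.integral_combine int) (auto simp: algebra_simps)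
    ultimately show ?case using Suc by (simp add: algebra_simps)
  qed simp
  have "integral {0..1} M = integral {0..r} M + integral {r..1 - r} M + integral {1 - r..1} M"
    using Henstock_Kurzweil_Integration.integral_combine[OF _ _ int, of 0 r "1 - r"]
      Henstock_Kurzweil_Integration.integral_combine[OF _ _ int, of 0 "1 - r" 1] r kd kd0 by simp
  then show ?thesis
    using first last middle[OF order_refl] unfolding kd side_distortion_def M_def[symmetric] d_def[symmetric]
    by linarith
qed

lemma triangle_centers_finite: "finite (triangle_centers r k P Q R)"
  and triangle_centers_nonempty: "triangle_centers r k P Q R \<noteq> {}"
  by (auto simp: triangle_centers_def corner_centers_def cell_centers_def)

lemma triangle_centers_distortion:
  assumes r: "0 < r" and k: "1 - 2 * r = real k * (sqrt 7 / 2 * r)" and eqt: "equilateral P Q R"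
  shows "triangle_distortion P Q R (triangle_centers r k P Q R) \<le> 7/16 * r\<^sup>2"
proof -
  let ?\<alpha> = "triangle_centers r k P Q R"
  note \<alpha> = triangle_centers_finite[of r k P Q R] triangle_centers_nonempty[of r k P Q R]
  note e2 = equilateral_rotate[OF eqt]
  note e3 = equilateral_rotate[OF e2]
  note mem = triangle_centers_def corner_centers_def
  define B where "B = 7/24 * r^3 + real k * ((sqrt 7 / 2 * r)^3 / 12)"
  have "real k * ((sqrt 7 / 2 * r)^3 / 12) = (1 - 2 * r) * (7/48 * r\<^sup>2)"
    unfolding k by (simp add: power2_eq_square power3_eq_cube)
  then have "3 * B = 7/16 * r\<^sup>2"
    unfolding B_def by (simp add: power2_eq_square power3_eq_cube field_simps)
  moreover have "side_distortion P Q ?\<alpha> \<le> B"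
    unfolding B_def by (rule side_distortion_le[OF r k eqt \<alpha>]) (auto simp: mem)
  moreover have "side_distortion Q R ?\<alpha> \<le> B"
    unfolding B_def by (rule side_distortion_le[OF r k e2 \<alpha>]) (auto simp: mem)
  moreover have "side_distortion R P ?\<alpha> \<le> B"
    unfolding B_def by (rule side_distortion_le[OF r k e3 \<alpha>]) (auto simp: mem)
  ultimately show ?thesis unfolding triangle_distortion_def by linarith
qed

lemma card_triangle_centers: "card (triangle_centers r k P Q R) \<le> 3 * k + 3"
proof -
  have c: "card (cell_centers r k P Q) \<le> k" for P Q :: 'a
    using card_image_le[of "{..<k}"] unfolding cell_centers_def by fastforce
  have c3: "card (corner_centers r P Q R) \<le> 3"
    unfolding corner_centers_def by (auto simp: card_insert_if)
  have "card (triangle_centers r k P Q R) \<le> card (corner_centers r P Q R)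
      + (card (cell_centers r k P Q) + card (cell_centers r k Q R) + card (cell_centers r k R P))"
    unfolding triangle_centers_def
    using card_Un_le[of "corner_centers r P Q R" "cell_centers r k P Q \<union> cell_centers r k Q R \<union> cell_centers r k R P"]
      card_Un_le[of "cell_centers r k P Q \<union> cell_centers r k Q R" "cell_centers r k R P"]
      card_Un_le[of "cell_centers r k P Q" "cell_centers r k Q R"] by linarith
  then show ?thesis using c[of P Q] c[of Q R] c[of R P] c3 by linarith
qed

section \<open>The uniform distribution on the triangle\<close>

lemma continuous_on_boundary_param: "continuous_on {0..3} boundary_param"
proof -
  have "continuous_on {0..1} boundary_param"
    by (rule continuous_on_eq[of _ "linepath vO vA"]) (auto simp: boundary_param_def intro: continuous_on_linepath)
  moreover have "continuous_on {1..2} boundary_param"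
    by (rule continuous_on_eq[of _ "\<lambda>t. linepath vA vB (t - 1)"])
       (auto simp: boundary_param_def linepath_def intro!: continuous_intros)
  moreover have "continuous_on {2..3} boundary_param"
    by (rule continuous_on_eq[of _ "\<lambda>t. linepath vB vO (t - 2)"])
       (auto simp: boundary_param_def linepath_def intro!: continuous_intros)
  ultimately have "continuous_on ({0..1} \<union> ({1..2} \<union> {2..3})) boundary_param"
    by (intro continuous_on_closed_Un) auto
  moreover have "{0..1} \<union> ({1..2} \<union> {2..3}) = {0..3::real}" by auto
  ultimately show ?thesis by simp
qed

lemma integral_uniform_triangle:
  fixes f :: "real^2 \<Rightarrow> real"
  assumes f: "continuous_on UNIV f"
  shows "(LINT x|uniform_triangle. f x) = 1/3 *
    (integral {0..1} (\<lambda>s. f (linepath vO vA s)) + integral {0..1} (\<lambda>s. f (linepath vA vB s))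
      + integral {0..1} (\<lambda>s. f (linepath vB vO s)))"
proof -
  let ?g = "\<lambda>t. f (boundary_param t)"
  have [measurable]: "f \<in> borel_measurable borel" using f by (rule borel_measurable_continuous_onI)
  have cont: "continuous_on {0..3} ?g"
    using continuous_on_compose2[OF f continuous_on_boundary_param] by simp
  have um: "uniform_measure lborel {0..3::real} = density lborel (\<lambda>t. ennreal (indicator {0..3} t / 3))"
    unfolding uniform_measure_def
    by (intro arg_cong[of _ _ "density lborel"] ext) (simp add: indicator_def divide_ennreal[symmetric])
  have "(LINT x|uniform_triangle. f x) = (LINT t|uniform_measure lborel {0..3}. ?g t)"
    unfolding uniform_triangle_def by (rule integral_distr) auto
  also have "\<dots> = (LINT t|lborel. (indicator {0..3} t / 3) *\<^sub>R ?g t)"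
    unfolding um by (rule integral_density) auto
  also have "\<dots> = 1/3 * (LINT t:{0..3}|lborel. ?g t)"
    unfolding set_lebesgue_integral_def by (subst integral_mult_right_zero[symmetric]) (simp add: mult.commute)
  also have "(LINT t:{0..3}|lborel. ?g t) = integral {0..3} ?g"
    by (rule set_borel_integral_eq_integral(2)) (rule borel_integrable_atLeastAtMost'[OF cont])
  also have "\<dots> = integral {0..1} ?g + integral {1..2} ?g + integral {2..3} ?g"
  proof -
    have int: "?g integrable_on {a..b}" if "0 \<le> a" "b \<le> 3" for a b
      using that by (intro integrable_continuous_real continuous_on_subset[OF cont]) auto
    have "integral {0..1} ?g + integral {1..3} ?g = integral {0..3} ?g"
      "integral {1..2} ?g + integral {2..3} ?g = integral {1..3} ?g"
      by (intro Henstock_Kurzweil_Integration.integral_combine int; simp)+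
    then show ?thesis by simp
  qed
  also have "integral {0..1} ?g = integral {0..1} (\<lambda>s. f (linepath vO vA s))"
    by (rule Henstock_Kurzweil_Integration.integral_cong) (simp add: boundary_param_def)
  also have "integral {1..2} ?g = integral {0..1} (\<lambda>s. f (linepath vA vB s))"
  proof -
    have "integral {1..2} ?g = integral {0..1} (\<lambda>s. ?g (s + 1))"
      using integral_shift_real_ivl[of 1 1 2 ?g] by simp
    also have "\<dots> = integral {0..1} (\<lambda>s. f (linepath vA vB s))"
      by (rule Henstock_Kurzweil_Integration.integral_cong) (auto simp: boundary_param_def linepath_def)
    finally show ?thesis .
  qed
  also have "integral {2..3} ?g = integral {0..1} (\<lambda>s. f (linepath vB vO s))"
  proof -
    have "integral {2..3} ?g = integral {0..1} (\<lambda>s. ?g (s + 2))"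
      using integral_shift_real_ivl[of 2 2 3 ?g] by simp
    also have "\<dots> = integral {0..1} (\<lambda>s. f (linepath vB vO s))"
      by (rule Henstock_Kurzweil_Integration.integral_cong) (auto simp: boundary_param_def linepath_def)
    finally show ?thesis .
  qed
  finally show ?thesis .
qed

lemma distortion_uniform_triangle:
  assumes "finite \<alpha>" "\<alpha> \<noteq> {}"
  shows "distortion uniform_triangle \<alpha> = 1/3 * triangle_distortion vO vA vB \<alpha>"
  unfolding distortion_def sq_dist_def[symmetric] integral_uniform_triangle[OF continuous_on_sq_dist[OF assms]]
    triangle_distortion_def side_distortion_def ..

lemma equilateral_unit_triangle: "equilateral vO vA vB"
  using side_lengths by (simp add: equilateral_def dist_norm norm_minus_commute)

lemma optimal_n_means_iff_unique_minimizer: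
  assumes fin: "finite \<beta>" "\<beta> \<noteq> {}" and card: "card \<beta> \<le> n" and val: "distortion P \<beta> = v"
    and lower: "\<And>\<alpha>. finite \<alpha> \<Longrightarrow> \<alpha> \<noteq> {} \<Longrightarrow> card \<alpha> \<le> n \<Longrightarrow> v \<le> distortion P \<alpha>"
    and unique: "\<And>\<alpha>. finite \<alpha> \<Longrightarrow> \<alpha> \<noteq> {} \<Longrightarrow> card \<alpha> \<le> n \<Longrightarrow> distortion P \<alpha> = v \<Longrightarrow> \<alpha> = \<beta>"
  shows "quantization_error P n = v" "optimal_n_means P n \<alpha> \<longleftrightarrow> \<alpha> = \<beta>"
proof -
  let ?S = "{\<alpha>. finite \<alpha> \<and> 1 \<le> card \<alpha> \<and> card \<alpha> \<le> n}"
  have iff: "finite \<alpha> \<and> 1 \<le> card \<alpha> \<longleftrightarrow> finite \<alpha> \<and> \<alpha> \<noteq> {}" for \<alpha> :: "'a set"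
    by (metis One_nat_def Suc_leI card_gt_0_iff not_one_le_zero card.empty)
  have mem: "\<beta> \<in> ?S" using fin card iff by blast
  have low: "v \<le> distortion P \<alpha>" if "\<alpha> \<in> ?S" for \<alpha> using that iff lower by blast
  show v: "quantization_error P n = v"
    unfolding quantization_error_def
  proof (rule antisym)
    have "bdd_below (distortion P ` ?S)" using low by (auto intro!: bdd_belowI[of _ v])
    then have "(INF \<alpha>\<in>?S. distortion P \<alpha>) \<le> distortion P \<beta>" by (rule cINF_lower[OF _ mem])
    then show "(INF \<alpha>\<in>?S. distortion P \<alpha>) \<le> v" unfolding val .
    show "v \<le> (INF \<alpha>\<in>?S. distortion P \<alpha>)" using mem low by (intro cINF_greatest) auto
  qed
  show "optimal_n_means P n \<alpha> \<longleftrightarrow> \<alpha> = \<beta>"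
  proof
    assume "optimal_n_means P n \<alpha>"
    then have "finite \<alpha>" "\<alpha> \<noteq> {}" "card \<alpha> \<le> n" "distortion P \<alpha> = v"
      unfolding optimal_n_means_def v by auto
    then show "\<alpha> = \<beta>" by (rule unique)
  next
    assume "\<alpha> = \<beta>"
    then show "optimal_n_means P n \<alpha>" using mem val unfolding optimal_n_means_def v by simp
  qed
qed

lemma affine_map_on_x_axis:
  fixes T :: "real^2 \<Rightarrow> 'b::real_vector"
  assumes "affine_map T"
  shows "T (vector [x, 0]) = T (vector [0, 0]) + x *\<^sub>R (T (vector [1, 0]) - T (vector [0, 0]))"
proof -
  obtain f b where f: "linear f" and T: "T = (\<lambda>x. f x + b)"
    using assms unfolding affine_map_def by blast
  have "vector [x, 0] = x *\<^sub>R (vector [1, 0] :: real^2)" "vector [0, 0] = (0 :: real^2)"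
    by (simp_all add: vec_eq_iff forall_2)
  then show ?thesis using f by (simp add: T linear_scale linear_0)
qed

lemma corner_centers_unit_triangle:
  "corner_centers r vO vA vB = {vector [3 * r / 8, sqrt 3 * r / 8],
     vector [1 - 3 * r / 8, sqrt 3 * r / 8], vector [1/2, - (sqrt 3 / 4) * (r - 2)]}"
proof -
  note defs = corner_center_def vO_def vA_def vB_def vec_eq_iff forall_2
  have "corner_center r vO vA vB = vector [3 * r / 8, sqrt 3 * r / 8]"
    "corner_center r vA vB vO = vector [1 - 3 * r / 8, sqrt 3 * r / 8]"
    by (simp_all add: defs)
  moreover have "corner_center r vB vO vA = vector [1/2, - (sqrt 3 / 4) * (r - 2)]"
    by (simp add: defs) (simp add: field_simps)
  ultimately show ?thesis unfolding corner_centers_def by simp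
qed

theorem theorem2p3p10:
  fixes n k :: nat
    and r :: real
    and \<gamma> \<alpha>\<^sub>n :: "(real^2) set"
    and T1 T2 :: "real^2 \<Rightarrow> real^2"
  assumes "n \<ge> 6" and "k \<ge> 1" and "n = 3 * k + 3"
    and "r = (8 - 2 * sqrt 7 * real k) / (16 - 7 * (real k)\<^sup>2)"
    and "\<gamma> = {vector [r + (2 * real j - 1) / (2 * real k) * (1 - 2 * r), 0] | j. j \<in> {1..k}}"
    and "affine_map T1" and "T1 (vector [0, 0]) = vector [1/2, sqrt 3 / 2]"
    and "T1 (vector [1, 0]) = vector [1, 0]"
    and "affine_map T2" and "T2 (vector [0, 0]) = vector [0, 0]"
    and "T2 (vector [1, 0]) = vector [1/2, sqrt 3 / 2]"
    and "\<alpha>\<^sub>n = {vector [3 * r / 8, sqrt 3 * r / 8],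
               vector [1 - 3 * r / 8, sqrt 3 * r / 8],
               vector [1/2, - (sqrt 3 / 4) * (r - 2)]}
              \<union> \<gamma> \<union> T1 ` \<gamma> \<union> T2 ` \<gamma>"
  shows "(\<forall>\<alpha>. optimal_n_means uniform_triangle n \<alpha> \<longleftrightarrow> \<alpha> = \<alpha>\<^sub>n)
    \<and> quantization_error uniform_triangle n =
          7 * (7 * (real k)\<^sup>2 - 8 * sqrt 7 * real k + 16)
            / (12 * (16 - 7 * (real k)\<^sup>2)\<^sup>2)"
proof -
  have "7 * (real k)\<^sup>2 \<noteq> 16"
  proof
    assume "7 * (real k)\<^sup>2 = 16"
    then have "real (7 * k\<^sup>2) = real 16" by simp
    then have "7 * k\<^sup>2 = 16" by (simp only: of_nat_eq_iff)
    then have "(7::nat) dvd 16" by (metis dvd_triv_left)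
    then show False by simp
  qed
  moreover have factor: "16 - 7 * (real k)\<^sup>2 = (4 - sqrt 7 * real k) * (4 + sqrt 7 * real k)"
    by (simp add: power2_eq_square field_simps)
  ultimately have nz: "4 - sqrt 7 * real k \<noteq> 0" "16 - 7 * (real k)\<^sup>2 \<noteq> 0" by auto
  have p: "4 + sqrt 7 * real k > 0" by (simp add: add_pos_nonneg)
  have req: "r = 2 / (4 + sqrt 7 * real k)"
  proof -
    have "8 - 2 * sqrt 7 * real k = (4 - sqrt 7 * real k) * 2" by simp
    then show ?thesis unfolding assms(4) factor
      by (simp only: mult_divide_mult_cancel_left[OF nz(1)])
  qed
  have s7: "sqrt 7 * real k \<ge> 1"
    using mult_mono[of 1 "sqrt 7" 1 "real k"] assms(2) by simp
  have r0: "r > 0" using p req by simp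
  have r: "r \<le> 2/5" unfolding req using s7 by (intro frac_le) auto
  have "r * (4 + sqrt 7 * real k) = 2"
    using req p nonzero_eq_divide_eq[of "4 + sqrt 7 * real k" r 2] by (metis less_irrefl)
  then have "r * 4 + r * (sqrt 7 * real k) = 2" by (simp only: distrib_left)
  moreover have "2 * (real k * (sqrt 7 / 2 * r)) = r * (sqrt 7 * real k)" by simp
  ultimately have k: "1 - 2 * r = real k * (sqrt 7 / 2 * r)" by linarith
  have k0: "real k > 0" using assms(2) by simp
  have \<gamma>: "\<gamma> = (\<lambda>i. vector [r + sqrt 7 / 4 * r + real i * (sqrt 7 / 2 * r), 0]) ` {..<k}"
  proof -
    have step: "r + (2 * real (Suc i) - 1) / (2 * real k) * (real k * (sqrt 7 / 2 * r))
        = r + sqrt 7 / 4 * r + real i * (sqrt 7 / 2 * r)" for i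
    proof -
      have "r + (2 * real (Suc i) - 1) / (2 * real k) * (real k * x) = r + x / 2 + real i * x" for x
        using k0 by (simp add: field_simps)
      from this[of "sqrt 7 / 2 * r"] show ?thesis by simp
    qed
    have "\<gamma> = (\<lambda>j. vector [r + (2 * real j - 1) / (2 * real k) * (1 - 2 * r), 0]) ` {1..k}"
      unfolding assms(5) by auto
    also have "{1..k} = Suc ` {..<k}" by (simp add: image_Suc_lessThan)
    also have "(\<lambda>j. vector [r + (2 * real j - 1) / (2 * real k) * (1 - 2 * r), 0] :: real^2) ` Suc ` {..<k}
       = (\<lambda>i. vector [r + sqrt 7 / 4 * r + real i * (sqrt 7 / 2 * r), 0]) ` {..<k}"
      unfolding image_image k step ..
    finally show ?thesis .
  qed
  have \<gamma>T: "T ` \<gamma> = cell_centers r k P Q"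
    if "affine_map T" "T (vector [0, 0]) = P" "T (vector [1, 0]) = Q" for T :: "real^2 \<Rightarrow> real^2" and P Q
  proof -
    have "T (vector [x, 0]) = P + x *\<^sub>R (Q - P)" for x
      using affine_map_on_x_axis[OF that(1), of x] unfolding that(2,3) .
    then show ?thesis unfolding \<gamma> cell_centers_def image_image by (simp only:)
  qed
  have "T1 ` \<gamma> = cell_centers r k vA vB"
    using \<gamma>T[OF assms(6-8)] cell_centers_commute[OF k] unfolding vA_def vB_def by metis
  moreover have "T2 ` \<gamma> = cell_centers r k vB vO"
    using \<gamma>T[OF assms(9-11)] cell_centers_commute[OF k] unfolding vO_def vB_def by metis
  moreover have "\<gamma> = cell_centers r k vO vA"
  proof -
    have "affine_map (id :: real^2 \<Rightarrow> real^2)"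
      unfolding affine_map_def by (intro exI[of _ id] exI[of _ 0]) (simp add: linear_id fun_eq_iff)
    from \<gamma>T[OF this refl refl] show ?thesis unfolding vO_def vA_def by simp
  qed
  ultimately have \<alpha>n: "\<alpha>\<^sub>n = triangle_centers r k vO vA vB"
    unfolding assms(12) triangle_centers_def corner_centers_unit_triangle by auto
  have fin: "finite \<alpha>\<^sub>n" "\<alpha>\<^sub>n \<noteq> {}" and card: "card \<alpha>\<^sub>n \<le> n"
    unfolding \<alpha>n assms(3)
    by (rule triangle_centers_finite triangle_centers_nonempty card_triangle_centers)+
  note lower = triangle_distortion_lower_bound[OF r0 r k equilateral_unit_triangle]
  have val: "distortion uniform_triangle \<alpha>\<^sub>n = 7/48 * r\<^sup>2"
  proof -
    have "triangle_distortion vO vA vB \<alpha>\<^sub>n = 7/16 * r\<^sup>2"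
    proof (rule antisym)
      show "triangle_distortion vO vA vB \<alpha>\<^sub>n \<le> 7/16 * r\<^sup>2"
        unfolding \<alpha>n by (rule triangle_centers_distortion[OF r0 k equilateral_unit_triangle])
      show "7/16 * r\<^sup>2 \<le> triangle_distortion vO vA vB \<alpha>\<^sub>n"
        using lower(1)[OF fin] card unfolding assms(3) by blast
    qed
    then show ?thesis unfolding distortion_uniform_triangle[OF fin] by simp
  qed
  have bound: "7/48 * r\<^sup>2 \<le> distortion uniform_triangle \<alpha>"
    if "finite \<alpha>" "\<alpha> \<noteq> {}" "card \<alpha> \<le> n" for \<alpha> :: "(real^2) set"
    using lower(1)[OF that(1,2)] that(3)
    unfolding distortion_uniform_triangle[OF that(1,2)] assms(3) by simp
  have unique: "\<alpha> = \<alpha>\<^sub>n"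
    if "finite \<alpha>" "\<alpha> \<noteq> {}" "card \<alpha> \<le> n" "distortion uniform_triangle \<alpha> = 7/48 * r\<^sup>2"
    for \<alpha> :: "(real^2) set"
  proof -
    have "triangle_distortion vO vA vB \<alpha> = 7/16 * r\<^sup>2"
      using that(4) unfolding distortion_uniform_triangle[OF that(1,2)] by simp
    then show ?thesis using lower(2)[OF that(1,2)] that(3) unfolding \<alpha>n assms(3) by blast
  qed
  have "quantization_error uniform_triangle n = 7/48 * r\<^sup>2"
    and "optimal_n_means uniform_triangle n \<alpha> \<longleftrightarrow> \<alpha> = \<alpha>\<^sub>n" for \<alpha>
    using optimal_n_means_iff_unique_minimizer[OF fin card val bound unique] by blast+
  moreover have "7/48 * r\<^sup>2 = 7 * (7 * (real k)\<^sup>2 - 8 * sqrt 7 * real k + 16)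
            / (12 * (16 - 7 * (real k)\<^sup>2)\<^sup>2)"
  proof -
    have "(8 - 2 * sqrt 7 * real k)\<^sup>2 = 4 * (7 * (real k)\<^sup>2 - 8 * sqrt 7 * real k + 16)"
      by (simp add: power2_eq_square algebra_simps)
    moreover have "7/48 * (4 * x / y) = 7 * x / (12 * y)" for x y :: real by simp
    ultimately show ?thesis unfolding assms(4) power_divide by (simp only:)
  qed
  ultimately show ?thesis by (simp only: simp_thms)
qed

end
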